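(* Let $\Omega$ be an open bounded convex domain in $\mathbb{R}^n$. Let $\{\Omega_m\}$ be a sequence of open, bounded, smooth and uniformly convex domains in $\mathbb{R}^n$ that converges to $\Omega$ in the Hausdorff distance. For each $m$, take $u_m\in C^{1,1}(\overline{\Omega_m})\cap C^\infty(\Omega_m)$ with $\|u_m\|_{L^\infty(\Omega_m)}=1$ to be a nonzero convex eigenfunction of the Monge-Ampère operator on $\Omega_m$: $$\det D^2u_m=\lambda(\Omega_m)|u_m|^n\ \text{in }\Omega_m,\qquad u_m=0\ \text{on }\partial\Omega_m.$$ Then we can find a subsequence of $\{m\}_{m=1}^\infty$, still denoted by $\{m\}_{m=1}^\infty$, such that $$\lim_{m\to\infty}\lambda(\Omega_m)=\Lambda>0$$ and $\{u_m\}$ converges uniformly on compact subsets of $\Omega$ to a nonzero convex solution $u$ of $$\det D^2u=\Lambda|u|^n\ \text{in }\Omega,\qquad u=0\ \text{on }\partial\Omega.$$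
   Context: The dimension $n\ge2$ is fixed. All bounded open convex domains are assumed to have nonempty interior. For a smooth, open, bounded, uniformly convex domain $D\subset\mathbb{R}^n$, $\lambda(D)$ denotes the unique positive constant (Lions) for which $\det D^2w=\lambda(D)|w|^n$ in $D$, $w=0$ on $\partial D$ has a nonzero convex solution $w\in C^{1,1}(\overline D)\cap C^\infty(D)$. For merely convex $u$ the equation $\det D^2u=f$ is understood in the Aleksandrov sense: $|\partial u(E)|=\int_Ef\,dx$ for all Borel $E\subset\Omega$, where $|\cdot|$ is Lebesgue measure, $\partial u(E)=\bigcup_{x\in E}\partial u(x)$ and $\partial u(x)=\{q\in\mathbb{R}^n:u(y)\ge u(x)+q\cdot(y-x)\ \forall y\in\Omega\}$. *)

theory Defs
  imports "HOL-Analysis.Analysis" "HOL-Probability.Essential_Supremum"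
begin

section \<open>Derivatives and smoothness classes\<close>

definition partial :: "'n \<Rightarrow> (real ^ 'n \<Rightarrow> real) \<Rightarrow> real ^ 'n \<Rightarrow> real" where
  "partial i f x = frechet_derivative f (at x) (axis i 1)"

definition grad :: "(real ^ 'n \<Rightarrow> real) \<Rightarrow> real ^ 'n \<Rightarrow> real ^ 'n" where
  "grad f x = (\<chi> i. partial i f x)"

definition hessian :: "(real ^ 'n \<Rightarrow> real) \<Rightarrow> real ^ 'n \<Rightarrow> real ^ 'n ^ 'n" where
  "hessian f x = (\<chi> i j. partial i (partial j f) x)"

text \<open>Membership in \<open>C\<^sup>k(S)\<close> and \<open>C\<^sup>\<infinity>(S)\<close>; meaningful for open \<open>S\<close>, since \<^const>\<open>partial\<close> uses
  full neighbourhoods.\<close>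

primrec Ck_on :: "nat \<Rightarrow> (real ^ 'n) set \<Rightarrow> (real ^ 'n \<Rightarrow> real) \<Rightarrow> bool" where
  "Ck_on 0 S f \<longleftrightarrow> continuous_on S f"
| "Ck_on (Suc k) S f \<longleftrightarrow>
     (\<forall>x\<in>S. f differentiable (at x)) \<and> (\<forall>i. Ck_on k S (partial i f))"

definition smooth_on :: "(real ^ 'n) set \<Rightarrow> (real ^ 'n \<Rightarrow> real) \<Rightarrow> bool" where
  "smooth_on S f \<longleftrightarrow> (\<forall>k. Ck_on k S f)"

text \<open>\<open>f \<in> C\<^sup>1\<^sup>,\<^sup>1\<close> of the closure of the open set \<open>D\<close>: \<open>f\<close> is continuous up to the boundary and its
  gradient extends to a Lipschitz map on the closure.\<close>

definition C11_closure :: "(real ^ 'n) set \<Rightarrow> (real ^ 'n \<Rightarrow> real) \<Rightarrow> bool" where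
  "C11_closure D f \<longleftrightarrow>
     continuous_on (closure D) f \<and>
     (\<forall>x\<in>D. f differentiable (at x)) \<and>
     (\<exists>L G. L-lipschitz_on (closure D) G \<and> (\<forall>x\<in>D. G x = grad f x))"


section \<open>Domains\<close>

definition convex_domain :: "(real ^ 'n) set \<Rightarrow> bool" where
  "convex_domain D \<longleftrightarrow> open D \<and> bounded D \<and> convex D \<and> D \<noteq> {}"

definition local_defining_function ::
    "(real ^ 'n) set \<Rightarrow> real ^ 'n \<Rightarrow> (real ^ 'n) set \<Rightarrow> (real ^ 'n \<Rightarrow> real) \<Rightarrow> bool" where
  "local_defining_function D p U \<rho> \<longleftrightarrow>
     open U \<and> p \<in> U \<and> smooth_on U \<rho> \<and> (\<forall>x\<in>U. grad \<rho> x \<noteq> 0) \<and> D \<inter> U = {x \<in> U. \<rho> x < 0}"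

definition smooth_boundary :: "(real ^ 'n) set \<Rightarrow> bool" where
  "smooth_boundary D \<longleftrightarrow> (\<forall>p\<in>frontier D. \<exists>U \<rho>. local_defining_function D p U \<rho>)"

text \<open>All principal curvatures of the boundary are at least some \<open>\<kappa> > 0\<close>: the second fundamental
  form of the boundary at \<open>p\<close>, with respect to the inner normal, is \<open>D\<^sup>2\<rho>(p) / |\<nabla>\<rho>(p)|\<close> restricted
  to the tangent space, for any local defining function \<open>\<rho>\<close>.  To be used together with
  \<^const>\<open>smooth_boundary\<close>, which guarantees that such a \<open>\<rho>\<close> exists.\<close>

definition uniformly_convex :: "(real ^ 'n) set \<Rightarrow> bool" where
  "uniformly_convex D \<longleftrightarrow> convex D \<and>
     (\<exists>\<kappa>>0. \<forall>p\<in>frontier D. \<forall>U \<rho>. local_defining_function D p U \<rho> \<longrightarrow>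
        (\<forall>v. v \<bullet> grad \<rho> p = 0 \<longrightarrow>
           v \<bullet> (hessian \<rho> p *v v) \<ge> \<kappa> * norm (grad \<rho> p) * (norm v)\<^sup>2))"

text \<open>The Hausdorff distance; meaningful for bounded nonempty sets.\<close>

definition hausdorff_distance :: "'a::metric_space set \<Rightarrow> 'a set \<Rightarrow> real" where
  "hausdorff_distance A B = max (SUP a\<in>A. infdist a B) (SUP b\<in>B. infdist b A)"

definition Linfty_norm :: "(real ^ 'n) set \<Rightarrow> (real ^ 'n \<Rightarrow> real) \<Rightarrow> ereal" where
  "Linfty_norm D f = esssup (lebesgue_on D) (\<lambda>x. ereal \<bar>f x\<bar>)"


section \<open>The Monge-Ampere eigenvalue problem\<close>

definition MA_eigenfunction :: "(real ^ 'n) set \<Rightarrow> real \<Rightarrow> (real ^ 'n \<Rightarrow> real) \<Rightarrow> bool" where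
  "MA_eigenfunction D l w \<longleftrightarrow>
     C11_closure D w \<and> smooth_on D w \<and> convex_on D w \<and> (\<exists>x\<in>D. w x \<noteq> 0) \<and>
     (\<forall>x\<in>D. det (hessian w x) = l * \<bar>w x\<bar> ^ CARD('n)) \<and>
     (\<forall>x\<in>frontier D. w x = 0)"

text \<open>Existence and uniqueness of the described constant, for smooth uniformly convex domains, is a
  theorem of Lions; it is not proved here.\<close>

definition MA_eigenvalue :: "(real ^ 'n) set \<Rightarrow> real" where
  "MA_eigenvalue D = (THE l. l > 0 \<and> (\<exists>w. MA_eigenfunction D l w))"

definition subdifferential :: "(real ^ 'n) set \<Rightarrow> (real ^ 'n \<Rightarrow> real) \<Rightarrow> real ^ 'n \<Rightarrow> (real ^ 'n) set"
  where "subdifferential D u x = {q. \<forall>y\<in>D. u y \<ge> u x + q \<bullet> (y - x)}"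

text \<open>\<open>det D\<^sup>2u = f\<close> in \<open>D\<close> in the sense of Aleksandrov.  The image of a Borel set under the
  subdifferential need not be Borel, hence the use of Lebesgue measurability; it is required
  explicitly because \<^const>\<open>emeasure\<close> is \<open>0\<close> on non-measurable sets.\<close>

definition aleksandrov_solution ::
    "(real ^ 'n) set \<Rightarrow> (real ^ 'n \<Rightarrow> real) \<Rightarrow> (real ^ 'n \<Rightarrow> real) \<Rightarrow> bool" where
  "aleksandrov_solution D u f \<longleftrightarrow>
     (\<forall>E \<in> sets borel. E \<subseteq> D \<longrightarrow>
        (\<Union>x\<in>E. subdifferential D u x) \<in> sets lebesgue \<and>
        emeasure lebesgue (\<Union>x\<in>E. subdifferential D u x)
          = (\<integral>\<^sup>+x\<in>E. ennreal (f x) \<partial>lebesgue))"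

end

theory Submission
  imports Defs "HOL-Complex_Analysis.Great_Picard" "HOL-Analysis.Regularity"
begin

text \<open>
  The domains converge, the eigenfunctions are normalized, and the claim is compactness together with
  stability of the Monge-Ampere equation. The eigenvalue enters only through the equation: every
  real number \<open>l\<close> that admits a normalized eigenfunction satisfies the estimates below.

  \<^bold>\<open>Mass of gradients.\<close> For a smooth convex solution the measure of the set of subgradients over \<open>E\<close> is the
  integral of \<open>l |w|\<^sup>n\<close> over \<open>E\<close>, because the gradient is injective where the Hessian is nonsingular
  and the change of variables formula applies (\<open>measure_subdifferential_smooth\<close>,
  \<open>eigenfunction_aleksandrov_solution\<close>).

  \<^bold>\<open>Estimates.\<close> If all domains lie in a fixed ball and contain a fixed smaller ball, comparison of this mass
  with the slopes of a cone over a point of the graph bounds \<open>l\<close> from below (\<open>eigenvalue_lower_bound\<close>) and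
  forces \<open>w\<close> to be uniformly small near the boundary (\<open>boundary_decay\<close>). Comparison with the
  interior gradient bound bounds \<open>l\<close> from above (\<open>eigenvalue_upper_bound\<close>).

  \<^bold>\<open>Compactness.\<close> Boundary decay and the interior gradient bound make the extensions by zero equicontinuous
  on the whole space (\<open>zero_extension_equicontinuous\<close>), so a subsequence converges uniformly. The limit is
  convex, vanishes on the boundary, and is not zero because the points with value \<open>-1\<close> stay away from
  the boundary. Convexity of the domains turns Hausdorff convergence into inclusion of slightly
  smaller balls (\<open>hausdorff_distance_ball_subset\<close>).

  \<^bold>\<open>Limit equation.\<close> Subgradients of the approximants converge to subgradients of the limit, and
  conversely almost every subgradient of the limit is attained by the approximants nearby. The
  exceptional slopes, attained at more than one point, form a null set
  (\<open>negligible_common_subgradients\<close>). This gives the equation on compact sets, and regularity of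
  measures extends it to Borel sets (\<open>aleksandrov_solution_limit\<close>).
\<close>

section \<open>Change of variables over an arbitrary finite index type\<close>

text \<open>The change of variables formula \<open>has_measure_differentiable_image\<close> concerns well-ordered index types. The type
  \<open>'a idx\<close> is a well-ordered copy of the finite type \<open>'a\<close>; renaming the coordinates along a bijection
  carries the theorem over to every finite index type.\<close>

typedef ('a::finite) idx = "{..<CARD('a)} :: nat set"
  by (rule exI[of _ 0]) simp

setup_lifting type_definition_idx

instantiation idx :: (finite) wellorder
begin
lift_definition less_eq_idx :: "'a idx \<Rightarrow> 'a idx \<Rightarrow> bool" is "(\<le>)" .
lift_definition less_idx :: "'a idx \<Rightarrow> 'a idx \<Rightarrow> bool" is "(<)" .
instance
proof (intro_classes)
  fix P :: "'a idx \<Rightarrow> bool" and a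
  assume step: "\<And>x. (\<And>y. y < x \<Longrightarrow> P y) \<Longrightarrow> P x"
  show "P a"
    by (induction a rule: measure_induct_rule[of Rep_idx]) (metis step less_idx.rep_eq)
qed (transfer; auto)+
end

instance idx :: (finite) finite
  by intro_classes (metis finite_imageI finite_lessThan type_definition.Abs_image type_definition_idx)

lemma card_idx: "CARD('a::finite idx) = CARD('a)"
  by (simp add: type_definition.card[OF type_definition_idx])

definition relabel :: "('i \<Rightarrow> 'j) \<Rightarrow> real ^ 'j \<Rightarrow> real ^ 'i" where
  "relabel \<sigma> x = (\<chi> i. x $ \<sigma> i)"

lemma relabel_nth [simp]: "relabel \<sigma> x $ i = x $ \<sigma> i"
  by (simp add: relabel_def)

lemma linear_relabel: "linear (relabel \<sigma>)"
  by (rule linearI) (simp_all add: vec_eq_iff)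

lemma relabel_inv:
  assumes "bij \<sigma>"
  shows "relabel \<sigma> (relabel (inv \<sigma>) x) = x" "relabel (inv \<sigma>) (relabel \<sigma> y) = y"
  using assms by (simp_all add: vec_eq_iff bij_is_inj bij_is_surj surj_f_inv_f)

lemma norm_relabel:
  assumes "bij \<sigma>"
  shows "norm (relabel \<sigma> x) = norm x"
  unfolding norm_vec_def L2_set_def relabel_nth
  by (intro arg_cong[where f=sqrt] sum.reindex_bij_betw assms)

lemma relabel_image_cbox:
  assumes "bij \<sigma>"
  shows "relabel \<sigma> ` cbox a b = cbox (relabel \<sigma> a) (relabel \<sigma> b)"
proof -
  have "x \<in> relabel \<sigma> ` cbox a b" if "x \<in> cbox (relabel \<sigma> a) (relabel \<sigma> b)" for x
  proof (rule image_eqI[of _ _ "relabel (inv \<sigma>) x"])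
    show "relabel (inv \<sigma>) x \<in> cbox a b"
      using that assms by (auto simp: mem_box_cart) (metis bij_inv_eq_iff)+
  qed (simp add: relabel_inv assms)
  then show ?thesis
    by (auto simp: mem_box_cart)
qed

lemma content_relabel_cbox:
  fixes \<sigma> :: "'i::finite \<Rightarrow> 'j::finite"
  assumes "bij \<sigma>"
  shows "measure lborel (relabel \<sigma> ` cbox a b) = measure lborel (cbox a b)"
proof -
  have "(\<forall>i. a $ \<sigma> i \<le> b $ \<sigma> i) \<longleftrightarrow> (\<forall>i. a $ i \<le> b $ i)"
    using assms by (metis bij_pointE)
  moreover have "(\<Prod>i\<in>UNIV. b $ \<sigma> i - a $ \<sigma> i) = (\<Prod>i\<in>UNIV. b $ i - a $ i)"
    using prod.reindex_bij_betw[OF assms, of "\<lambda>i. b $ i - a $ i"] by simp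
  ultimately show ?thesis
    by (auto simp: relabel_image_cbox assms content_cbox_if_cart interval_eq_empty_cart simp flip: not_le)
qed

text \<open>Renaming coordinates maps boxes to boxes of the same volume and balls about the origin to
  themselves, which is all that the definition of the gauge integral refers to.\<close>

lemma has_integral_relabel:
  fixes \<sigma> :: "'i::finite \<Rightarrow> 'j::finite" and f :: "real ^ 'i \<Rightarrow> real"
  assumes "bij \<sigma>" "(f has_integral m) S"
  shows "((\<lambda>x. f (relabel \<sigma> x)) has_integral m) (relabel \<sigma> -` S)"
proof -
  let ?f = "\<lambda>x. if x \<in> S then f x else 0"
  have box: "((\<lambda>x. ?f (relabel \<sigma> x)) has_integral z) (cbox a b)"
    if "(?f has_integral z) (cbox (relabel \<sigma> a) (relabel \<sigma> b))" for z a b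
  proof -
    have "((\<lambda>x. ?f (relabel \<sigma> x)) has_integral (1/1) *\<^sub>R z)
        (relabel (inv \<sigma>) ` cbox (relabel \<sigma> a) (relabel \<sigma> b))"
    proof (rule has_integral_twiddle)
      show "continuous (at x) (relabel \<sigma> :: real^'j \<Rightarrow> _)" for x
        by (intro linear_continuous_at linear_conv_bounded_linear[THEN iffD1] linear_relabel)
      show "\<exists>w z. relabel \<sigma> ` cbox u v = cbox w z" for u v
        using relabel_image_cbox[OF assms(1)] by blast
      show "\<exists>w z. relabel (inv \<sigma>) ` cbox u v = cbox w z" for u v
        using relabel_image_cbox[OF bij_imp_bij_inv[OF assms(1)]] by blast
      show "(?f has_integral z) (cbox (relabel \<sigma> a) (relabel \<sigma> b))"
        by (rule that)
    qed (simp_all add: relabel_inv assms(1) content_relabel_cbox)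
    then show ?thesis
      using assms(1) by (simp add: relabel_image_cbox bij_imp_bij_inv relabel_inv)
  qed
  have "(?f has_integral m) UNIV"
    using assms(2) by (simp only: has_integral_restrict_UNIV)
  then have main: "\<forall>e>0. \<exists>B>0. \<forall>a b. ball 0 B \<subseteq> cbox a b \<longrightarrow>
      (\<exists>z. (?f has_integral z) (cbox a b) \<and> norm (z - m) < e)"
  proof (intro allI impI)
    fix e :: real assume "e > 0"
    moreover have "\<nexists>a b. (UNIV :: (real^'i) set) = cbox a b"
      by (metis bounded_cbox not_bounded_UNIV)
    ultimately obtain B where "B > 0" "\<forall>a b. ball 0 B \<subseteq> cbox a b \<longrightarrow>
      (\<exists>z. ((\<lambda>x. if x \<in> UNIV then ?f x else 0) has_integral z) (cbox a b) \<and> norm (z - m) < e)"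
      by (rule_tac has_integral_altD[OF \<open>(?f has_integral m) UNIV\<close>])
    then show "\<exists>B>0. \<forall>a b. ball 0 B \<subseteq> cbox a b \<longrightarrow>
      (\<exists>z. (?f has_integral z) (cbox a b) \<and> norm (z - m) < e)"
      by auto
  qed
  let ?g = "\<lambda>x. ?f (relabel \<sigma> x)"
  have g: "\<forall>e>0. \<exists>B>0. \<forall>a b. ball 0 B \<subseteq> cbox a b \<longrightarrow>
      (\<exists>z. ((\<lambda>x. if x \<in> UNIV then ?g x else 0) has_integral z) (cbox a b) \<and> norm (z - m) < e)"
  proof (intro allI impI)
    fix e :: real assume "e > 0"
    then obtain B where B: "B > 0" "\<And>a b. ball 0 B \<subseteq> cbox a b \<Longrightarrow>
        \<exists>z. (?f has_integral z) (cbox a b) \<and> norm (z - m) < e"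
      using main by blast
    have ex: "\<exists>z. (?g has_integral z) (cbox a b) \<and> norm (z - m) < e"
      if ab: "ball 0 B \<subseteq> cbox a b" for a b
    proof -
      have "x \<in> cbox (relabel \<sigma> a) (relabel \<sigma> b)" if "x \<in> ball 0 B" for x
      proof -
        have "relabel (inv \<sigma>) x \<in> cbox a b"
          using that norm_relabel[OF bij_imp_bij_inv[OF assms(1)], of x] by (intro subsetD[OF ab]) simp
        then show ?thesis
          unfolding relabel_image_cbox[OF assms(1), symmetric]
          by (rule rev_image_eqI) (simp add: relabel_inv assms(1))
      qed
      then have "ball 0 B \<subseteq> cbox (relabel \<sigma> a) (relabel \<sigma> b)" by (rule subsetI)
      from B(2)[OF this] obtain z
        where "(?f has_integral z) (cbox (relabel \<sigma> a) (relabel \<sigma> b))" "norm (z - m) < e"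
        by (elim exE conjE)
      with box[OF this(1)] show ?thesis by (intro exI conjI)
    qed
    then show "\<exists>B>0. \<forall>a b. ball 0 B \<subseteq> cbox a b \<longrightarrow>
      (\<exists>z. ((\<lambda>x. if x \<in> UNIV then ?g x else 0) has_integral z) (cbox a b) \<and> norm (z - m) < e)"
      using B(1) ex unfolding if_P[OF UNIV_I] by meson
  qed
  have "(\<exists>a b. (UNIV :: (real^'j) set) = cbox a b) = False"
    by (metis bounded_cbox not_bounded_UNIV)
  then have "(?g has_integral m) UNIV"
    by (subst has_integral_alt) (simp only: if_False, rule g)
  then have "((\<lambda>x. if x \<in> relabel \<sigma> -` S then f (relabel \<sigma> x) else 0) has_integral m) UNIV"
    by (simp only: vimage_eq)
  then show ?thesis
    by (simp only: has_integral_restrict_UNIV)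
qed

text \<open>Conjugation by \<open>\<sigma>\<close> is a sign-preserving bijection between the permutations of the two index
  types, so it matches the terms of the two Leibniz expansions.\<close>

lemma det_relabel:
  fixes \<sigma> :: "'i::finite \<Rightarrow> 'j::finite" and A :: "real ^ 'j ^ 'j"
  assumes "bij \<sigma>"
  shows "det (\<chi> i k. A $ \<sigma> i $ \<sigma> k) = det A"
proof -
  let ?F = "\<lambda>p i. \<sigma> (p (inv \<sigma> i))"
  have F: "map_permutation UNIV \<sigma> p = ?F p" for p
    using bij_is_surj[OF assms] by (simp add: map_permutation_def restrict_id_def fun_eq_iff)
  have "bij_betw ?F {p. p permutes UNIV} {p. p permutes UNIV}"
    using bij_betw_permutations[OF assms] by simp
  then have "det A = (\<Sum>p | p permutes UNIV. of_int (sign (?F p)) * (\<Prod>i\<in>UNIV. A $ i $ ?F p i))"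
    unfolding det_def by (rule sum.reindex_bij_betw[symmetric])
  also have "\<dots> = det (\<chi> i k. A $ \<sigma> i $ \<sigma> k)"
    unfolding det_def
  proof (rule sum.cong[OF refl], clarsimp)
    fix p :: "'i \<Rightarrow> 'i" assume "p permutes UNIV"
    then have "sign (?F p) = sign p"
      using sign_map_permutation[of \<sigma> UNIV p] bij_is_inj[OF assms] F by simp
    moreover have "(\<Prod>i\<in>UNIV. A $ i $ ?F p i) = (\<Prod>i\<in>UNIV. A $ \<sigma> i $ \<sigma> (p i))"
      using prod.reindex_bij_betw[OF assms, of "\<lambda>i. A $ i $ ?F p i"] bij_is_inj[OF assms] by simp
    ultimately show "real_of_int (sign (?F p)) * (\<Prod>i\<in>UNIV. A $ i $ ?F p i) =
        real_of_int (sign p) * (\<Prod>i\<in>UNIV. A $ \<sigma> i $ \<sigma> (p i))" by simp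
  qed
  finally show ?thesis ..
qed

text \<open>The theorem \<open>has_measure_differentiable_image\<close>, applied to the map conjugated by the coordinate
  renaming; both its integral and its Jacobian are unchanged by the renaming.\<close>

lemma has_measure_injective_differentiable_image:
  fixes f :: "real ^ 'n \<Rightarrow> real ^ 'n"
  assumes "S \<in> sets lebesgue"
    and "\<And>x. x \<in> S \<Longrightarrow> (f has_derivative f' x) (at x within S)"
    and "inj_on f S"
    and "((\<lambda>x. \<bar>det (matrix (f' x))\<bar>) has_integral m) S"
  shows "f ` S \<in> lmeasurable \<and> measure lebesgue (f ` S) = m"
proof -
  obtain \<sigma> :: "'n idx \<Rightarrow> 'n" where \<sigma>: "bij \<sigma>"
    using card_idx finite_same_card_bij[OF finite finite] by metis
  let ?T = "relabel \<sigma>" and ?R = "relabel (inv \<sigma>)"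
  have \<sigma>': "bij (inv \<sigma>)" by (rule bij_imp_bij_inv[OF \<sigma>])
  note [simp] = relabel_inv[OF \<sigma>]
  have blin: "bounded_linear (relabel \<tau> :: real^'p \<Rightarrow> real^'q)" for \<tau> :: "'q::finite \<Rightarrow> 'p::finite"
    by (rule linear_conv_bounded_linear[THEN iffD1, OF linear_relabel])
  let ?S = "?R -` S"
  have S_eq: "?S = ?T ` S"
    by (auto intro: rev_image_eqI)
  let ?g = "?T \<circ> f \<circ> ?R" and ?g' = "\<lambda>x. ?T \<circ> f' (?R x) \<circ> ?R"
  have lebS: "?S \<in> sets lebesgue"
    unfolding S_eq
  proof (rule differentiable_image_in_sets_lebesgue[OF assms(1)])
    show "DIM(real^'n) \<le> DIM(real^'n idx)" by (simp add: card_idx)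
    show "relabel \<sigma> differentiable_on S"
      using blin bounded_linear_imp_differentiable_on by blast
  qed
  have derg: "(?g has_derivative ?g' x) (at x within ?S)" if "x \<in> ?S" for x
  proof -
    have "(?R has_derivative ?R) (at x within ?S)"
      using blin bounded_linear_imp_has_derivative by blast
    moreover have "(f has_derivative f' (?R x)) (at (?R x) within ?R ` ?S)"
      using that assms(2)[of "?R x"] by (rule_tac has_derivative_subset) auto
    moreover have "(?T has_derivative ?T) (at ((f \<circ> ?R) x) within (f \<circ> ?R) ` ?S)"
      using blin bounded_linear_imp_has_derivative by blast
    ultimately show ?thesis
      unfolding comp_assoc by (intro diff_chain_within)
  qed
  have injg: "inj_on ?g ?S"
  proof (rule inj_onI)
    fix x y assume *: "x \<in> ?S" "y \<in> ?S" "?g x = ?g y"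
    then have "?R (?g x) = ?R (?g y)" by (rule_tac arg_cong)
    then have "?R x = ?R y" using * assms(3) by (simp add: inj_on_eq_iff)
    then have "?T (?R x) = ?T (?R y)" by (rule arg_cong)
    then show "x = y" by simp
  qed
  have detg: "det (matrix (?g' x)) = det (matrix (f' (?R x)))" for x
  proof -
    have "matrix (?g' x) = (\<chi> i k. matrix (f' (?R x)) $ \<sigma> i $ \<sigma> k)"
    proof -
      have "?R (axis k 1) = axis (\<sigma> k) 1" for k
        using \<sigma> by (simp add: vec_eq_iff axis_def bij_inv_eq_iff) (metis \<sigma> bij_inv_eq_iff)
      then show ?thesis unfolding matrix_def comp_def by (simp only:) (simp add: vec_eq_iff)
    qed
    then show ?thesis by (simp add: det_relabel[OF \<sigma>])
  qed
  have "((\<lambda>x. \<bar>det (matrix (?g' x))\<bar>) has_integral m) ?S"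
    unfolding detg using has_integral_relabel[OF \<sigma>' assms(4)] by simp
  then have "?g ` ?S \<in> lmeasurable \<and> measure lebesgue (?g ` ?S) = m"
    using has_measure_differentiable_image[OF lebS derg injg] by blast
  then have "(indicat_real (?g ` ?S) has_integral m) UNIV"
    using lmeasurable_iff_indicator_has_integral by blast
  then have "((\<lambda>x. indicat_real (?g ` ?S) (?T x)) has_integral m) UNIV"
    using has_integral_relabel[OF \<sigma>, of "indicat_real (?g ` ?S)" m UNIV] by simp
  moreover have "indicat_real (?g ` ?S) (?T x) = indicat_real (f ` S) x" for x
  proof -
    have "?T x \<in> ?g ` ?S \<longleftrightarrow> x \<in> f ` S"
    proof
      assume "?T x \<in> ?g ` ?S"
      then obtain y where "y \<in> ?S" "?T x = ?T (f (?R y))" by auto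
      then have "?R (?T x) = ?R (?T (f (?R y)))" by (rule_tac arg_cong)
      then show "x \<in> f ` S" using \<open>y \<in> ?S\<close> by auto
    next
      assume "x \<in> f ` S"
      then obtain y where "y \<in> S" "x = f y" by auto
      then show "?T x \<in> ?g ` ?S" by (intro image_eqI[of _ _ "?T y"]) auto
    qed
    then show ?thesis by (simp add: indicator_def)
  qed
  ultimately show ?thesis
    using lmeasurable_iff_indicator_has_integral[of "f ` S" m] by auto
qed


section \<open>Gradients and Hessians\<close>

lemma has_derivative_grad:
  assumes "f differentiable (at x)"
  shows "(f has_derivative (\<lambda>h. grad f x \<bullet> h)) (at x)"
proof -
  have der: "(f has_derivative frechet_derivative f (at x)) (at x)"
    using assms frechet_derivative_works by blast
  then have lin: "linear (frechet_derivative f (at x))"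
    by (rule has_derivative_linear)
  have "frechet_derivative f (at x) h = grad f x \<bullet> h" for h
  proof -
    have "frechet_derivative f (at x) h = frechet_derivative f (at x) (\<Sum>i\<in>UNIV. h $ i *s axis i 1)"
      by (simp add: basis_expansion)
    also have "\<dots> = (\<Sum>i\<in>UNIV. h $ i * frechet_derivative f (at x) (axis i 1))"
      by (simp add: linear_sum[OF lin] linear_scale[OF lin] scalar_mult_eq_scaleR)
    also have "\<dots> = grad f x \<bullet> h"
      by (simp add: inner_vec_def grad_def partial_def mult.commute)
    finally show ?thesis .
  qed
  then have "frechet_derivative f (at x) = (\<lambda>h. grad f x \<bullet> h)" by blast
  with der show ?thesis by simp
qed

text \<open>The transpose appears because \<^const>\<open>hessian\<close> puts the outer derivative in the row index.\<close>

lemma grad_has_derivative_hessian: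
  assumes "\<And>j. partial j f differentiable (at x)"
  shows "(grad f has_derivative (\<lambda>h. transpose (hessian f x) *v h)) (at x)"
proof -
  have "((\<lambda>y. grad f y $ j) has_derivative (\<lambda>h. (transpose (hessian f x) *v h) $ j)) (at x)" for j
  proof -
    have "(transpose (hessian f x) *v h) $ j = grad (partial j f) x \<bullet> h" for h
      by (simp add: matrix_vector_mult_def transpose_def hessian_def inner_vec_def grad_def)
    then show ?thesis
      using has_derivative_grad[OF assms[of j]] by (simp add: grad_def)
  qed
  then show ?thesis
    by (subst has_derivative_componentwise_within)
       (auto simp: Basis_vec_def inner_axis)
qed

lemma smooth_on_differentiable:
  assumes "smooth_on D u" "x \<in> D"
  shows "u differentiable (at x)" "partial j u differentiable (at x)"
proof -
  have "Ck_on 2 D u" using assms(1) by (simp add: smooth_on_def)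
  then show "u differentiable (at x)" "partial j u differentiable (at x)"
    using assms(2) by (simp_all add: numeral_2_eq_2)
qed

lemma det_nonzero_iff_kernel:
  fixes A :: "real ^ 'n ^ 'n"
  shows "det A \<noteq> 0 \<longleftrightarrow> (\<forall>h. A *v h = 0 \<longrightarrow> h = 0)"
  by (metis invertible_det_nz invertible_left_inverse matrix_left_invertible_ker)

text \<open>On the segment from \<open>A\<close> to the identity the quadratic form is positive definite except possibly
  at \<open>A\<close>, so the determinant cannot vanish before \<open>A\<close> is reached; it is \<open>1\<close> at the identity and
  therefore cannot have become negative.\<close>

lemma det_nonneg_of_accretive:
  fixes A :: "real ^ 'n ^ 'n"
  assumes "\<And>h. 0 \<le> h \<bullet> (A *v h)"
  shows "0 \<le> det A"
proof (rule ccontr)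
  assume neg: "\<not> 0 \<le> det A"
  define B where "B s = s *\<^sub>R mat 1 + (1 - s) *\<^sub>R A" for s :: real
  have "continuous_on {0..1} (\<lambda>s. det (B s))"
    unfolding det_def B_def by (auto intro!: continuous_intros)
  moreover have "det (B 0) < 0" "det (B 1) = 1"
    using neg by (simp_all add: B_def)
  ultimately obtain s where s: "0 \<le> s" "s \<le> 1" "det (B s) = 0"
    using IVT'[of "\<lambda>s. det (B s)" 0 0 1] by auto
  with \<open>det (B 0) < 0\<close> have "s > 0" by (cases "s = 0") auto
  from s(3) obtain h where h: "h \<noteq> 0" "B s *v h = 0"
    using det_nonzero_iff_kernel by blast
  have "h \<bullet> (B s *v h) = s * (h \<bullet> h) + (1 - s) * (h \<bullet> (A *v h))"
    by (simp add: B_def matrix_vector_mult_add_rdistrib scaleR_matrix_vector_assoc[symmetric]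
        inner_add_right)
  moreover have "s * (h \<bullet> h) > 0" "(1 - s) * (h \<bullet> (A *v h)) \<ge> 0"
    using \<open>s > 0\<close> h(1) s(2) assms by simp_all
  ultimately show False using h(2) by simp
qed


section \<open>Subdifferentials of convex functions\<close>

lemma subdifferential_monotone:
  assumes "p \<in> subdifferential D u x" "q \<in> subdifferential D u y" "x \<in> D" "y \<in> D"
  shows "0 \<le> (p - q) \<bullet> (x - y)"
proof -
  have "u y \<ge> u x + p \<bullet> (y - x)" "u x \<ge> u y + q \<bullet> (x - y)"
    using assms by (auto simp: subdifferential_def)
  then show ?thesis by (simp add: inner_diff_left inner_diff_right)
qed

text \<open>One inclusion is the tangent inequality, obtained from the one-dimensional case along segments.
  For the other, a subgradient \<open>q\<close> makes \<open>u - q\<close> minimal at \<open>x\<close>, so its derivative vanishes there.\<close>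

lemma subdifferential_differentiable:
  fixes u :: "real ^ 'n \<Rightarrow> real"
  assumes "open D" "convex_on D u" "x \<in> D" "u differentiable (at x)"
  shows "subdifferential D u x = {grad u x}"
proof -
  have der: "(u has_derivative (\<lambda>h. grad u x \<bullet> h)) (at x)"
    by (rule has_derivative_grad) fact
  have "u x + grad u x \<bullet> (y - x) \<le> u y" if "y \<in> D" for y
  proof -
    define g where "g t = x + t *\<^sub>R (y - x)" for t :: real
    let ?A = "g -` D"
    have "continuous_on UNIV g" unfolding g_def by (intro continuous_intros)
    then have "open ?A" using assms(1) by (simp add: open_vimage continuous_on_eq_continuous_at)
    have g_aff: "g ((1 - s) * a + s * b) = (1 - s) *\<^sub>R g a + s *\<^sub>R g b" for s a b
      by (simp add: g_def algebra_simps)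
    have "convex D" using assms(2) convex_on_imp_convex by blast
    have cA: "convex ?A"
      unfolding convex_alt using convexD_alt[OF \<open>convex D\<close>] g_aff by auto
    have "convex_on ?A (u \<circ> g)"
      using cA convex_onD[OF assms(2)] by (intro convex_onI) (auto simp: g_aff)
    moreover have der0: "((u \<circ> g) has_real_derivative grad u x \<bullet> (y - x)) (at 0)"
    proof -
      have "(g has_derivative (\<lambda>t. t *\<^sub>R (y - x))) (at 0)"
        unfolding g_def by (auto intro!: derivative_eq_intros)
      moreover have "(u has_derivative (\<lambda>h. grad u x \<bullet> h)) (at (g 0))"
        using der by (simp add: g_def)
      ultimately have "((u \<circ> g) has_derivative ((\<lambda>h. grad u x \<bullet> h) \<circ> (\<lambda>t. t *\<^sub>R (y - x)))) (at 0)"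
        by (rule diff_chain_at)
      then show ?thesis
        unfolding has_field_derivative_def o_def inner_scaleR_right mult.commute[of _ "grad u x \<bullet> (y - x)"] .
    qed
    ultimately have "(u \<circ> g) 1 - (u \<circ> g) 0 \<ge> grad u x \<bullet> (y - x) * (1 - 0)"
      using assms(3) that
      by (intro convex_on_imp_above_tangent[OF _ convex_connected[OF cA] _ _
            has_field_derivative_at_within[OF der0]])
         (simp_all add: interior_open \<open>open ?A\<close> g_def)
    then show ?thesis by (simp add: g_def)
  qed
  moreover have "q = grad u x" if q: "\<And>y. y \<in> D \<Longrightarrow> u x + q \<bullet> (y - x) \<le> u y" for q
  proof -
    have "((\<lambda>y. u y - q \<bullet> y) has_derivative (\<lambda>h. grad u x \<bullet> h - q \<bullet> h)) (at x)"
      using der by (auto intro!: derivative_eq_intros)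
    moreover have "\<forall>y\<in>D. u x - q \<bullet> x \<le> u y - q \<bullet> y"
      using q by (fastforce simp: inner_diff_right)
    ultimately have "(\<lambda>h. grad u x \<bullet> h - q \<bullet> h) = (\<lambda>h. 0)"
      using differential_zero_maxmin[OF assms(3,1)] by blast
    then have "(grad u x - q) \<bullet> h = 0" for h
      by (metis inner_diff_left)
    then show ?thesis by (metis eq_iff_diff_eq_0 inner_eq_zero_iff)
  qed
  ultimately show ?thesis by (auto simp: subdifferential_def)
qed

text \<open>Closedness of the graph of the subdifferential, with the function and its domain allowed to vary
  along the sequence. A constant sequence of functions gives compactness of subgradient images;
  the approximating eigenfunctions give one half of the convergence of Monge-Ampere measures.\<close>

lemma subdifferential_limit:
  fixes x :: "nat \<Rightarrow> real ^ 'n"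
  assumes "\<And>k. p k \<in> subdifferential (D k) (v k) (x k)"
    and "x \<longlonglongrightarrow> a" "p \<longlonglongrightarrow> q" "(\<lambda>k. v k (x k)) \<longlonglongrightarrow> w a"
    and "\<And>y. y \<in> E \<Longrightarrow> \<forall>\<^sub>F k in sequentially. y \<in> D k"
    and "\<And>y. y \<in> E \<Longrightarrow> (\<lambda>k. v k y) \<longlonglongrightarrow> w y"
  shows "q \<in> subdifferential E w a"
proof -
  have "w a + q \<bullet> (y - a) \<le> w y" if "y \<in> E" for y
  proof (rule tendsto_le[OF sequentially_bot])
    show "(\<lambda>k. v k y) \<longlonglongrightarrow> w y" by (rule assms(6)[OF that])
    show "(\<lambda>k. v k (x k) + p k \<bullet> (y - x k)) \<longlonglongrightarrow> w a + q \<bullet> (y - a)"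
      by (intro tendsto_intros assms)
    show "\<forall>\<^sub>F k in sequentially. v k (x k) + p k \<bullet> (y - x k) \<le> v k y"
      using assms(5)[OF that] by eventually_elim (use assms(1) in \<open>auto simp: subdifferential_def\<close>)
  qed
  then show ?thesis by (simp add: subdifferential_def)
qed

lemma subgradient_norm_bound:
  fixes u :: "real ^ 'n \<Rightarrow> real"
  assumes "p \<in> subdifferential D u x" "cball x d \<subseteq> D" "0 < d"
    and "\<And>y. y \<in> cball x d \<Longrightarrow> u y - u x \<le> M"
  shows "norm p \<le> M / d"
proof (cases "p = 0")
  case True
  then show ?thesis using assms(3) assms(4)[of x] by simp
next
  case False
  define y where "y = x + (d / norm p) *\<^sub>R p"
  have y: "y \<in> cball x d" using False assms(3) by (simp add: y_def dist_norm)
  then have "u y \<ge> u x + p \<bullet> (y - x)"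
    using assms(1,2) by (auto simp: subdifferential_def)
  moreover have "p \<bullet> (y - x) = d * norm p"
    using False by (simp add: y_def power2_norm_eq_inner[symmetric] power2_eq_square)
  ultimately have "d * norm p \<le> M" using assms(4)[OF y] by simp
  then show ?thesis using assms(3) by (simp add: field_simps)
qed

lemma compact_enlargement:
  fixes K :: "'a::heine_borel set"
  assumes "compact K" "open D" "K \<subseteq> D"
  obtains d C where "d > 0" "compact C" "C \<subseteq> D" "\<And>x. x \<in> K \<Longrightarrow> cball x d \<subseteq> C"
proof (cases "K = {}")
  case True
  then show ?thesis using that[of 1 "{}"] by simp
next
  case False
  obtain e where e: "e > 0" "(\<Union>x\<in>K. cball x e) \<subseteq> D"
    using compact_subset_open_imp_cball_epsilon_subset[OF assms] by blast
  let ?C = "{x. infdist x K \<le> e}"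
  have "?C \<subseteq> D"
  proof
    fix x assume "x \<in> ?C"
    obtain y where "y \<in> K" "infdist x K = dist x y"
      using infdist_attains_inf[OF compact_imp_closed[OF assms(1)] False] by blast
    with \<open>x \<in> ?C\<close> have "x \<in> cball y e" by (simp add: dist_commute)
    with \<open>y \<in> K\<close> e show "x \<in> D" by blast
  qed
  moreover have "cball x e \<subseteq> ?C" if "x \<in> K" for x
    using infdist_le[OF that] by (force simp: dist_commute intro: order_trans)
  ultimately show ?thesis
    using that[OF e(1) compact_infdist_le[OF False assms(1) e(1)]] by blast
qed

lemma compact_subdifferential_image:
  fixes u :: "real ^ 'n \<Rightarrow> real"
  assumes "open D" "convex_on D u" "compact K" "K \<subseteq> D"
  shows "compact (\<Union>x\<in>K. subdifferential D u x)"
proof -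
  have cont: "continuous_on D u" by (rule convex_on_continuous[OF assms(1,2)])
  let ?S = "\<Union>x\<in>K. subdifferential D u x"
  have "bounded ?S"
  proof -
    obtain e C where C: "e > 0" "compact C" "C \<subseteq> D" "\<And>x. x \<in> K \<Longrightarrow> cball x e \<subseteq> C"
      using compact_enlargement[OF assms(3,1,4)] by metis
    have "compact (u ` C)"
      by (rule compact_continuous_image[OF continuous_on_subset[OF cont C(3)] C(2)])
    then obtain M where M: "\<And>x. x \<in> C \<Longrightarrow> \<bar>u x\<bar> \<le> M"
      using compact_imp_bounded bounded_iff by (metis imageI real_norm_def)
    have "norm p \<le> (2 * M) / e" if "x \<in> K" "p \<in> subdifferential D u x" for p x
    proof (rule subgradient_norm_bound[OF that(2) _ C(1)])
      show "cball x e \<subseteq> D" using C(3) C(4)[OF that(1)] by blast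
      fix y assume "y \<in> cball x e"
      then have "y \<in> C" "x \<in> C" using C(1) C(4)[OF that(1)] by auto
      then show "u y - u x \<le> 2 * M" using M[of x] M[of y] by auto
    qed
    then show ?thesis by (auto simp: bounded_iff)
  qed
  moreover have "closed ?S"
    unfolding closed_sequential_limits
  proof (intro allI impI)
    fix p q assume "(\<forall>n. p n \<in> ?S) \<and> p \<longlonglongrightarrow> q"
    then have p: "\<And>n. p n \<in> ?S" "p \<longlonglongrightarrow> q" by auto
    then obtain x where x: "\<And>n. x n \<in> K" "\<And>n. p n \<in> subdifferential D u (x n)"
      unfolding UN_iff Bex_def by metis
    obtain a r where a: "a \<in> K" "strict_mono (r :: nat \<Rightarrow> nat)" "(x \<circ> r) \<longlonglongrightarrow> a"
      using assms(3) x(1) compact_def by blast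
    have "q \<in> subdifferential D u a"
    proof (rule subdifferential_limit[of "p \<circ> r" "\<lambda>_. D" "\<lambda>_. u" "x \<circ> r"])
      show "(\<lambda>k. u ((x \<circ> r) k)) \<longlonglongrightarrow> u a"
      proof (rule continuous_on_tendsto_compose[OF cont a(3)])
        show "a \<in> D" using a(1) assms(4) by blast
        show "\<forall>\<^sub>F k in sequentially. (x \<circ> r) k \<in> D" using x(1) assms(4) by (auto intro: always_eventually)
      qed
    qed (use x a p LIMSEQ_subseq_LIMSEQ in auto)
    then show "q \<in> ?S" using a(1) by blast
  qed
  ultimately show ?thesis by (simp add: compact_eq_bounded_closed)
qed

text \<open>The translates of \<open>T\<close> by \<open>e, e/2, e/3, \<dots>\<close> are pairwise disjoint, have the same measure and all lie
  in one ball, so their common measure is zero.\<close>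

lemma negligible_disjoint_translates:
  fixes e :: "real ^ 'n"
  assumes "compact T" "\<And>p s. p \<in> T \<Longrightarrow> 0 < s \<Longrightarrow> p + s *\<^sub>R e \<notin> T"
  shows "negligible T"
proof -
  obtain R where R: "\<And>p. p \<in> T \<Longrightarrow> norm p \<le> R"
    using compact_imp_bounded[OF assms(1)] bounded_iff by blast
  \<comment> \<open>the shifts \<open>1 / (n + 1)\<close> are distinct, positive and bounded by \<open>1\<close>\<close>
  define A where "A n = (+) (inverse (real (Suc n)) *\<^sub>R e) ` T" for n
  have lm: "T \<in> lmeasurable" by (rule lmeasurable_compact[OF assms(1)])
  have meas: "A n \<in> lmeasurable" "measure lebesgue (A n) = measure lebesgue T" for n
    using lm by (auto simp: A_def measure_translation measurable_translation)
  have sub: "A n \<subseteq> cball 0 (R + norm e)" for n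
  proof
    fix y assume "y \<in> A n"
    then obtain p where p: "p \<in> T" "y = inverse (real (Suc n)) *\<^sub>R e + p" by (auto simp: A_def)
    have "inverse (real (Suc n)) \<le> 1" by (simp add: field_simps)
    then have "inverse (real (Suc n)) * norm e \<le> norm e" by (simp add: mult_left_le_one_le)
    then have "norm y \<le> norm e + R"
      unfolding p(2) using R[OF p(1)] norm_triangle_ineq[of "inverse (real (Suc n)) *\<^sub>R e" p]
      by simp
    then show "y \<in> cball 0 (R + norm e)" by simp
  qed
  have disj: "A m \<inter> A n = {}" if "m < n" for m n
  proof (rule ccontr)
    assume "A m \<inter> A n \<noteq> {}"
    then obtain p q where *: "p \<in> T" "q \<in> T"
      "inverse (real (Suc m)) *\<^sub>R e + p = inverse (real (Suc n)) *\<^sub>R e + q"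
      by (auto simp: A_def)
    then have "q = p + (inverse (real (Suc m)) - inverse (real (Suc n))) *\<^sub>R e"
      by (simp add: algebra_simps)
    moreover have "inverse (real (Suc m)) - inverse (real (Suc n)) > 0"
      using that by simp
    ultimately show False using assms(2) * by blast
  qed
  then have df: "disjoint_family_on A S" for S
    unfolding disjoint_family_on_def by (metis inf_commute linorder_neqE_nat)
  let ?B = "cball 0 (R + norm e) :: (real^'n) set"
  have "real N * measure lebesgue T \<le> measure lebesgue ?B" for N
  proof -
    have "real N * measure lebesgue T = (\<Sum>n<N. measure lebesgue (A n))"
      by (simp add: meas)
    also have "\<dots> = measure lebesgue (\<Union>n<N. A n)"
      using fmeasurableD[OF meas(1)] fmeasurableD2[OF meas(1)]
      by (intro measure_finite_Union[symmetric] df) auto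
    also have "\<dots> \<le> measure lebesgue ?B"
      using meas(1) sub by (intro measure_mono_fmeasurable) auto
    finally show ?thesis .
  qed
  note bound = this
  have "measure lebesgue T \<le> 0"
  proof (rule ccontr)
    assume "\<not> measure lebesgue T \<le> 0"
    then obtain N where "measure lebesgue ?B < real N * measure lebesgue T"
      using ex_less_of_nat_mult[of "measure lebesgue T" "measure lebesgue ?B"] by auto
    with bound[of N] show False by linarith
  qed
  then have "measure lebesgue T = 0" using measure_nonneg[of lebesgue T] by linarith
  then show ?thesis using lm negligible_iff_measure by blast
qed

text \<open>At these slopes the Legendre transform of \<open>u\<close> fails to be differentiable. If \<open>p\<close> is a subgradient at \<open>x\<close> and at \<open>y\<close>, then rational numbers
  \<open>a < b\<close> separate some coordinate \<open>x $ i < y $ i\<close>. For fixed \<open>i, a, b\<close>, and \<open>x\<close>, \<open>y\<close> in fixed compact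
  sets, such slopes form an intersection of two compact sets, and monotonicity of the
  subdifferential lets every line in direction \<open>i\<close> meet it at most once. Hence it has disjoint
  translates, and the whole set is a countable union of null sets.\<close>

lemma negligible_common_subgradients:
  fixes u :: "real ^ 'n \<Rightarrow> real"
  assumes "open D" "convex_on D u"
  shows "negligible {p. \<exists>x\<in>D. \<exists>y\<in>D. x \<noteq> y \<and> p \<in> subdifferential D u x \<and> p \<in> subdifferential D u y}"
proof -
  obtain C where C: "\<And>n::nat. compact (C n)" "\<And>n. C n \<subseteq> D" "\<Union>(range C) = D"
    using open_Union_compact_subsets[OF assms(1)] by metis
  define P where "P A = (\<Union>x\<in>A. subdifferential D u x)" for A
  define T where "T i a b k l = P (C k \<inter> {x. x $ i \<le> a}) \<inter> P (C l \<inter> {x. b \<le> x $ i})"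
    for i :: 'n and a b k l
  have neg: "negligible (T i a b k l)" if "a < b" for i a b k l
  proof (rule negligible_disjoint_translates[where e="axis i 1"])
    have "closed {x :: real^'n. x $ i \<le> a}" "closed {x :: real^'n. b \<le> x $ i}"
      by (auto intro!: closed_Collect_le continuous_intros)
    then show "compact (T i a b k l)"
      unfolding T_def P_def using C assms
      by (intro compact_Int compact_subdifferential_image compact_Int_closed) auto
    fix p and s :: real assume p: "p \<in> T i a b k l" and "0 < s"
    show "p + s *\<^sub>R axis i 1 \<notin> T i a b k l"
    proof
      assume "p + s *\<^sub>R axis i 1 \<in> T i a b k l"
      then obtain x where x: "x \<in> D" "x $ i \<le> a" "p + s *\<^sub>R axis i 1 \<in> subdifferential D u x"
        using C(2) by (auto simp: T_def P_def)
      obtain y where y: "y \<in> D" "b \<le> y $ i" "p \<in> subdifferential D u y"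
        using p C(2) by (auto simp: T_def P_def)
      have "0 \<le> s * (x $ i - y $ i)"
        using subdifferential_monotone[OF x(3) y(3) x(1) y(1)] by (simp add: inner_axis')
      with \<open>0 < s\<close> x(2) y(2) that show False by (simp add: zero_le_mult_iff)
    qed
  qed
  have neg': "negligible (\<Union>i. \<Union>(a,b)\<in>{(a,b)\<in>\<rat>\<times>\<rat>. a < b}. \<Union>k. \<Union>l. T i a b k l)"
    unfolding negligible_iff_null_sets
  proof (intro null_sets_UN')
    show "countable {(a :: real, b). (a, b) \<in> \<rat> \<times> \<rat> \<and> a < b}"
      by (rule countable_subset[of _ "\<rat> \<times> \<rat>"]) (auto simp: countable_rat)
  qed (use neg in \<open>auto simp: negligible_iff_null_sets intro!: null_sets_UN'\<close>)
  have key: "p \<in> (\<Union>i. \<Union>(a,b)\<in>{(a,b)\<in>\<rat>\<times>\<rat>. a < b}. \<Union>k. \<Union>l. T i a b k l)"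
    if "x \<in> D" "y \<in> D" "x $ i < y $ i"
      and "p \<in> subdifferential D u x" "p \<in> subdifferential D u y" for p x y and i :: 'n
  proof -
    obtain a where a: "a \<in> \<rat>" "x $ i < a" "a < y $ i"
      using Rats_dense_in_real[OF \<open>x $ i < y $ i\<close>] by blast
    obtain b where b: "b \<in> \<rat>" "a < b" "b < y $ i" using Rats_dense_in_real[OF a(3)] by blast
    obtain k l where "x \<in> C k" "y \<in> C l" using \<open>x \<in> D\<close> \<open>y \<in> D\<close> C(3) by blast
    then have "p \<in> T i a b k l" using a(2) b(3) that(4,5) by (auto simp: T_def P_def)
    then show ?thesis using a(1) b(1,2) by auto blast
  qed
  have "p \<in> (\<Union>i. \<Union>(a,b)\<in>{(a,b)\<in>\<rat>\<times>\<rat>. a < b}. \<Union>k. \<Union>l. T i a b k l)"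
    if "x \<in> D" "y \<in> D" "x \<noteq> y" "p \<in> subdifferential D u x" "p \<in> subdifferential D u y" for p x y
  proof -
    obtain i where "x $ i \<noteq> y $ i" using \<open>x \<noteq> y\<close> by (auto simp: vec_eq_iff)
    then consider "x $ i < y $ i" | "y $ i < x $ i" by linarith
    then show ?thesis
    proof cases
      case 1
      show ?thesis by (rule key[OF that(1,2) 1 that(4,5)])
    next
      case 2
      show ?thesis by (rule key[OF that(2,1) 2 that(5,4)])
    qed
  qed
  then show ?thesis
    by (intro negligible_subset[OF neg']) blast
qed


section \<open>The Monge-Ampere measure of a smooth convex function\<close>

lemma subdifferential_smooth:
  assumes "open D" "convex_on D u" "smooth_on D u" "x \<in> D"
  shows "subdifferential D u x = {grad u x}"
  using assms smooth_on_differentiable(1) by (intro subdifferential_differentiable) auto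

lemma grad_directional_derivative:
  assumes "smooth_on D u" "x \<in> D"
  shows "((\<lambda>t. grad u (x + t *\<^sub>R h)) has_vector_derivative transpose (hessian u x) *v h) (at 0 within T)"
proof -
  have "((\<lambda>t. x + t *\<^sub>R h) has_derivative (\<lambda>t. t *\<^sub>R h)) (at 0 within T)"
    by (auto intro!: derivative_eq_intros)
  moreover have "(grad u has_derivative (\<lambda>h. transpose (hessian u x) *v h)) (at (x + 0 *\<^sub>R h))"
    using grad_has_derivative_hessian[of u x] smooth_on_differentiable(2)[OF assms]
    by (simp del: transpose_matrix_vector)
  ultimately have "((\<lambda>t. grad u (x + t *\<^sub>R h)) has_derivative (\<lambda>t. transpose (hessian u x) *v (t *\<^sub>R h))) (at 0 within T)"
    by (rule has_derivative_compose)
  then show ?thesis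
    by (simp add: has_vector_derivative_def matrix_vector_mult_scaleR del: transpose_matrix_vector)
qed

text \<open>A supporting paraboloid at \<open>x\<close> improves the monotonicity of the gradient to
  \<open>c |y - x|\<^sup>2 \<le> (grad u y - grad u x) \<bullet> (y - x)\<close>; dividing by \<open>t\<^sup>2\<close> for \<open>y = x + t h\<close> gives the claim.
  The case \<open>c = 0\<close> is positive semidefiniteness of the Hessian of a convex function; the case \<open>c > 0\<close>
  produces a point where the Hessian of an eigenfunction is nonsingular.\<close>

lemma hessian_form_lower_bound:
  fixes u :: "real ^ 'n \<Rightarrow> real"
  assumes "open D" "convex_on D u" "smooth_on D u" "x \<in> D"
    and supp: "\<And>y. y \<in> D \<Longrightarrow> u x + p \<bullet> (y - x) + c * (norm (y - x))\<^sup>2 \<le> u y" and "0 \<le> c"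
  shows "c * (norm h)\<^sup>2 \<le> h \<bullet> (transpose (hessian u x) *v h)"
proof -
  have p: "p = grad u x"
  proof -
    have "p \<in> subdifferential D u x"
      using supp \<open>0 \<le> c\<close> by (force simp: subdifferential_def intro: order_trans[rotated])
    then show ?thesis using subdifferential_smooth[OF assms(1-4)] by simp
  qed
  have "((\<lambda>t. h \<bullet> grad u (x + t *\<^sub>R h)) has_real_derivative h \<bullet> (transpose (hessian u x) *v h)) (at_right 0)"
    using has_derivative_inner_right[OF grad_directional_derivative[OF assms(3,4), of h "{0<..}",
          unfolded has_vector_derivative_def], of h]
    by (simp add: has_field_derivative_def mult.commute[of _ "h \<bullet> _"] del: transpose_matrix_vector)
  then have lim: "((\<lambda>t. (h \<bullet> (grad u (x + t *\<^sub>R h) - grad u x)) / t) \<longlongrightarrow>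
      h \<bullet> (transpose (hessian u x) *v h)) (at_right 0)"
    by (simp add: has_field_derivative_iff inner_diff_right del: transpose_matrix_vector)
  have "\<forall>\<^sub>F t in at_right 0. x + t *\<^sub>R h \<in> D"
  proof -
    have "((\<lambda>t. x + t *\<^sub>R h) \<longlongrightarrow> x + 0 *\<^sub>R h) (at_right 0)" by (intro tendsto_intros)
    then show ?thesis using topological_tendstoD[OF _ assms(1)] assms(4) by simp
  qed
  moreover have "\<forall>\<^sub>F t in at_right (0::real). 0 < t" by (simp add: eventually_at_right_less)
  ultimately have "\<forall>\<^sub>F t in at_right 0. c * (norm h)\<^sup>2 \<le> (h \<bullet> (grad u (x + t *\<^sub>R h) - grad u x)) / t"
  proof eventually_elim
    case (elim t)
    let ?y = "x + t *\<^sub>R h"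
    have "grad u ?y \<in> subdifferential D u ?y"
      using elim(1) assms by (simp add: subdifferential_smooth)
    then have "u ?y + grad u ?y \<bullet> (x - ?y) \<le> u x"
      using assms(4) unfolding subdifferential_def by blast
    moreover have "u x + grad u x \<bullet> (?y - x) + c * (norm (?y - x))\<^sup>2 \<le> u ?y"
      using supp[OF elim(1)] p by simp
    ultimately have "c * (t\<^sup>2 * (norm h)\<^sup>2) \<le> t * (h \<bullet> (grad u ?y - grad u x))"
      by (simp add: inner_diff_right inner_commute[of h] power_mult_distrib algebra_simps)
    then have "t * (t * (c * (norm h)\<^sup>2)) \<le> t * (h \<bullet> (grad u ?y - grad u x))"
      by (simp add: power2_eq_square algebra_simps)
    then show ?case using elim(2) by (simp add: mult_le_cancel_left_pos pos_le_divide_eq mult.commute)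
  qed
  then show ?thesis using tendsto_lowerbound[OF lim] by simp
qed

lemma det_hessian_nonneg:
  fixes u :: "real ^ 'n \<Rightarrow> real"
  assumes "open D" "convex_on D u" "smooth_on D u" "x \<in> D"
  shows "0 \<le> det (hessian u x)"
proof -
  have "grad u x \<in> subdifferential D u x" using assms by (simp add: subdifferential_smooth)
  then have "0 * (norm h)\<^sup>2 \<le> h \<bullet> (transpose (hessian u x) *v h)" for h
    using assms by (intro hessian_form_lower_bound) (auto simp: subdifferential_def)
  then show ?thesis
    using det_nonneg_of_accretive[of "transpose (hessian u x)"] by (simp add: det_transpose)
qed

text \<open>If the gradient takes the same value \<open>p\<close> at \<open>x\<close> and \<open>y\<close>, then \<open>u\<close> is affine with slope \<open>p\<close> on the segment
  between them, so the gradient is constant there and the Hessian annihilates \<open>y - x\<close>.\<close>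

lemma inj_on_grad:
  fixes u :: "real ^ 'n \<Rightarrow> real"
  assumes "open D" "convex_on D u" "smooth_on D u" "\<And>x. x \<in> D \<Longrightarrow> det (hessian u x) \<noteq> 0"
  shows "inj_on (grad u) D"
proof (rule inj_onI, rule ccontr)
  fix x y assume xy: "x \<in> D" "y \<in> D" "grad u x = grad u y" "x \<noteq> y"
  let ?p = "grad u x" and ?h = "y - x"
  have px: "?p \<in> subdifferential D u x" and py: "?p \<in> subdifferential D u y"
    using xy assms by (simp_all add: subdifferential_smooth)
  have uy: "u y = u x + ?p \<bullet> ?h"
    using px py xy by (fastforce simp: subdifferential_def inner_diff_right)
  have const: "grad u (x + t *\<^sub>R ?h) = ?p" if "t \<in> {0..1}" for t
  proof -
    let ?z = "x + t *\<^sub>R ?h"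
    have z: "?z = (1 - t) *\<^sub>R x + t *\<^sub>R y" by (simp add: algebra_simps)
    have "?z \<in> D"
      using convexD_alt[OF convex_on_imp_convex[OF assms(2)] xy(1,2)] that z by simp
    have "u ?z \<le> (1 - t) * u x + t * u y"
      using convex_onD[OF assms(2), of t x y] that xy z by simp
    then have "u ?z \<le> u x + t * (?p \<bullet> ?h)" unfolding uy by (simp add: algebra_simps)
    then have "?p \<in> subdifferential D u ?z"
      using px by (fastforce simp: subdifferential_def inner_diff_right inner_add_right algebra_simps)
    then show ?thesis using \<open>?z \<in> D\<close> assms by (simp add: subdifferential_smooth)
  qed
  have "((\<lambda>t. grad u (x + t *\<^sub>R ?h)) has_vector_derivative 0) (at 0 within {0..1})"
    by (rule has_vector_derivative_transform[of _ _ _ "\<lambda>_. ?p"]) (use const in auto)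
  moreover have "at (0::real) within {0..1} \<noteq> bot" by (simp add: trivial_limit_within islimpt_greaterThanLessThan1)
  ultimately have "transpose (hessian u x) *v ?h = 0"
    using grad_directional_derivative[OF assms(3) xy(1)] vector_derivative_unique_within by blast
  moreover have "det (transpose (hessian u x)) \<noteq> 0"
    using assms(4)[OF xy(1)] by (simp add: det_transpose)
  ultimately have "?h = 0"
    using det_nonzero_iff_kernel by blast
  then show False using xy(4) by simp
qed

text \<open>For smooth \<open>u\<close> the Monge-Ampere measure has density \<open>det D\<^sup>2u\<close>: this is the change of variables formula
  for the gradient map.\<close>

lemma measure_subdifferential_smooth:
  fixes u :: "real ^ 'n \<Rightarrow> real"
  assumes "open D" "convex_on D u" "smooth_on D u" "\<And>x. x \<in> D \<Longrightarrow> det (hessian u x) \<noteq> 0"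
    and "E \<in> sets lebesgue" "E \<subseteq> D" "((\<lambda>x. det (hessian u x)) has_integral m) E"
  shows "(\<Union>x\<in>E. subdifferential D u x) \<in> lmeasurable"
    and "measure lebesgue (\<Union>x\<in>E. subdifferential D u x) = m"
proof -
  have "(\<Union>x\<in>E. subdifferential D u x) = grad u ` E"
    using assms by (auto simp: subdifferential_smooth subset_iff)
  moreover have "grad u ` E \<in> lmeasurable \<and> measure lebesgue (grad u ` E) = m"
  proof (rule has_measure_injective_differentiable_image)
    show "(grad u has_derivative (\<lambda>h. transpose (hessian u x) *v h)) (at x within E)" if "x \<in> E" for x
      using that assms(3,6) smooth_on_differentiable(2)
      by (blast intro: has_derivative_at_withinI grad_has_derivative_hessian)
    show "inj_on (grad u) E"
      using inj_on_grad[OF assms(1-4)] assms(6) inj_on_subset by blast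
    show "((\<lambda>x. \<bar>det (matrix ((*v) (transpose (hessian u x))))\<bar>) has_integral m) E"
    proof (rule has_integral_eq[OF _ assms(7)])
      fix x assume "x \<in> E"
      then have "0 \<le> det (hessian u x)"
        using assms(6) det_hessian_nonneg[OF assms(1-3)] by blast
      then show "det (hessian u x) = \<bar>det (matrix ((*v) (transpose (hessian u x))))\<bar>"
        by (simp add: det_transpose del: transpose_matrix_vector)
    qed
  qed (use assms in auto)
  ultimately show "(\<Union>x\<in>E. subdifferential D u x) \<in> lmeasurable"
    "measure lebesgue (\<Union>x\<in>E. subdifferential D u x) = m" by auto
qed


section \<open>Stability of the Aleksandrov equation\<close>

text \<open>By inner regularity of \<open>\<nu>\<close>, a Borel set is an increasing union of compact sets up to
  a \<open>\<nu>\<close>-null remainder \<open>N\<close>. The remainder lies in open sets of small \<open>\<nu>\<close>-measure; these are again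
  unions of compact sets, so their images are small and the image of \<open>N\<close> is a null set, hence
  measurable by completeness of Lebesgue measure.\<close>

lemma emeasure_image_of_compacts:
  fixes S :: "'a::euclidean_space \<Rightarrow> 'b::euclidean_space set" and \<nu> :: "'a measure"
  assumes sets: "sets \<nu> = sets borel" and fin: "emeasure \<nu> (space \<nu>) \<noteq> \<infinity>" and "open D"
    and cpt: "\<And>K. compact K \<Longrightarrow> K \<subseteq> D \<Longrightarrow>
        (\<Union>x\<in>K. S x) \<in> sets lebesgue \<and> emeasure lebesgue (\<Union>x\<in>K. S x) = emeasure \<nu> K"
    and E: "E \<in> sets borel" "E \<subseteq> D"
  shows "(\<Union>x\<in>E. S x) \<in> sets lebesgue \<and> emeasure lebesgue (\<Union>x\<in>E. S x) = emeasure \<nu> E"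
proof -
  define P where "P A = (\<Union>x\<in>A. S x)" for A
  have P_mono: "P A \<subseteq> P B" if "A \<subseteq> B" for A B using that by (auto simp: P_def)
  note sets[simp]
  have fin': "emeasure \<nu> A \<noteq> \<infinity>" for A
    using fin emeasure_space[of \<nu> A] by (metis infinity_ennreal_def neq_top_trans)
  have sigma: "P (\<Union>n. L n) \<in> sets lebesgue \<and> emeasure lebesgue (P (\<Union>n. L n)) = emeasure \<nu> (\<Union>n. L n)"
    if L: "\<And>n::nat. compact (L n)" "\<And>n. L n \<subseteq> D" "incseq L" for L
  proof -
    have eq: "P (\<Union>n. L n) = (\<Union>n. P (L n))" by (auto simp: P_def)
    have meas: "P (L n) \<in> sets lebesgue" "emeasure lebesgue (P (L n)) = emeasure \<nu> (L n)" for n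
      using cpt[OF L(1,2)] by (auto simp: P_def)
    have "incseq (\<lambda>n. P (L n))" using L(3) P_mono by (simp add: incseq_def)
    then have "emeasure lebesgue (\<Union>n. P (L n)) = (SUP n. emeasure lebesgue (P (L n)))"
      using meas(1) by (intro SUP_emeasure_incseq[symmetric]) auto
    also have "\<dots> = (SUP n. emeasure \<nu> (L n))" by (simp add: meas)
    also have "\<dots> = emeasure \<nu> (\<Union>n. L n)"
      using L by (intro SUP_emeasure_incseq) (auto intro: borel_compact)
    finally show ?thesis using eq meas(1) by auto
  qed
  obtain L where L: "\<And>n::nat. compact (L n)" "\<And>n. L n \<subseteq> E" "incseq L"
      "emeasure \<nu> (E - (\<Union>n. L n)) = 0"
  proof -
    have "\<exists>K. compact K \<and> K \<subseteq> E \<and> emeasure \<nu> E < emeasure \<nu> K + ennreal (inverse (real (Suc n)))" for n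
    proof -
      have "\<exists>K\<in>{K. K \<subseteq> E \<and> compact K}. emeasure \<nu> E < emeasure \<nu> K + ennreal (inverse (real (Suc n)))"
        by (rule SUP_approx_ennreal[OF _ _ inner_regular[OF sets fin E(1)] fin']) auto
      then show ?thesis by blast
    qed
    then obtain K where K: "\<And>n::nat. compact (K n)" "\<And>n. K n \<subseteq> E"
        "\<And>n. emeasure \<nu> E < emeasure \<nu> (K n) + ennreal (inverse (real (Suc n)))"
      by metis
    define L where "L n = (\<Union>i\<le>n. K i)" for n
    have L: "compact (L n)" "L n \<subseteq> E" for n
      using K(1,2) by (auto simp: L_def intro: compact_UN)
    have "incseq L" unfolding L_def incseq_def by force
    moreover have "emeasure \<nu> (E - (\<Union>n. L n)) = 0"
    proof -
      have LE: "(\<Union>n. L n) \<in> sets borel" using L(1) by (auto intro: borel_compact)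
      have "emeasure \<nu> E \<le> emeasure \<nu> (\<Union>n. L n)"
      proof (rule ennreal_le_epsilon)
        fix e :: real assume "e > 0"
        then obtain n where n: "inverse (real (Suc n)) < e" using reals_Archimedean by blast
        have "emeasure \<nu> E \<le> emeasure \<nu> (K n) + ennreal (inverse (real (Suc n)))"
          using K(3)[of n] by simp
        also have "\<dots> \<le> emeasure \<nu> (\<Union>n. L n) + ennreal e"
        proof (rule add_mono)
          show "emeasure \<nu> (K n) \<le> emeasure \<nu> (\<Union>n. L n)"
            using LE by (intro emeasure_mono) (auto simp: L_def)
        qed (use n in \<open>auto intro: ennreal_leI\<close>)
        finally show "emeasure \<nu> E \<le> emeasure \<nu> (\<Union>n. L n) + ennreal e" .
      qed
      moreover have "emeasure \<nu> (E - (\<Union>n. L n)) = emeasure \<nu> E - emeasure \<nu> (\<Union>n. L n)"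
        using LE E(1) L(2) fin' by (intro emeasure_Diff) auto
      ultimately show ?thesis using fin'[of E] by (simp add: diff_eq_0_iff_ennreal less_top)
    qed
    ultimately show ?thesis using that L by blast
  qed
  define F where "F = (\<Union>n. L n)"
  have F: "F \<in> sets borel" "F \<subseteq> E" using L(1,2) by (auto simp: F_def intro: borel_compact)
  have PF: "P F \<in> sets lebesgue" "emeasure lebesgue (P F) = emeasure \<nu> F"
    unfolding F_def using sigma[of L] L E(2) by auto
  have "negligible (P (E - F))"
    unfolding negligible_outer_le
  proof (intro allI impI)
    fix e :: real assume "e > 0"
    have N: "E - F \<in> sets borel" "emeasure \<nu> (E - F) = 0"
      using E(1) F(1) L(4) by (auto simp: F_def)
    have "\<exists>U\<in>{U. E - F \<subseteq> U \<and> open U}. emeasure \<nu> U < emeasure \<nu> (E - F) + ennreal e"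
      using \<open>e > 0\<close> by (intro INF_approx_ennreal[OF _ outer_regular[OF sets fin N(1)] fin']) auto
    then obtain U where U: "open U" "E - F \<subseteq> U" "emeasure \<nu> U < ennreal e" using N(2) by auto
    obtain C where C: "\<And>n::nat. compact (C n)" "\<And>n. C n \<subseteq> U \<inter> D" "\<And>n. C n \<subseteq> interior (C (Suc n))"
        "\<Union>(range C) = U \<inter> D"
      using open_Union_compact_subsets[OF open_Int[OF U(1) \<open>open D\<close>]] by metis
    have "incseq C" using C(3) interior_subset by (intro incseq_SucI) blast
    then have T: "P (U \<inter> D) \<in> sets lebesgue" "emeasure lebesgue (P (U \<inter> D)) = emeasure \<nu> (U \<inter> D)"
      using sigma[of C] C by auto
    have "emeasure \<nu> (U \<inter> D) \<le> emeasure \<nu> U"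
      using U(1) \<open>open D\<close> by (intro emeasure_mono) auto
    then have le: "emeasure lebesgue (P (U \<inter> D)) \<le> ennreal e" using U(3) T(2) by simp
    then have lm: "P (U \<inter> D) \<in> lmeasurable"
      using T(1) by (intro fmeasurableI) (auto simp: le_less_trans)
    moreover have "measure lebesgue (P (U \<inter> D)) \<le> e"
      unfolding measure_def using le \<open>e > 0\<close> by (intro enn2real_leI) auto
    moreover have "P (E - F) \<subseteq> P (U \<inter> D)" using U(2) E(2) by (intro P_mono) auto
    ultimately show "\<exists>T. P (E - F) \<subseteq> T \<and> T \<in> lmeasurable \<and> measure lebesgue T \<le> e" by blast
  qed
  then have null: "P (E - F) \<in> null_sets lebesgue" by (simp add: negligible_iff_null_sets)
  have PE: "P E = P F \<union> P (E - F)" using F(2) by (auto simp: P_def)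
  have "emeasure \<nu> E = emeasure \<nu> F + emeasure \<nu> (E - F)"
    using F E(1) plus_emeasure[of F \<nu> "E - F"] by (simp add: Un_absorb1)
  then have "emeasure \<nu> E = emeasure \<nu> F" using L(4) by (simp add: F_def)
  moreover have "emeasure lebesgue (P E) = emeasure lebesgue (P F)"
    unfolding PE by (rule emeasure_Un_null_set[OF PF(1) null])
  moreover have "P E \<in> sets lebesgue" unfolding PE using PF(1) null by auto
  ultimately show ?thesis using PF(2) by (simp add: P_def)
qed

text \<open>If \<open>p\<close> is a subgradient at \<open>x0\<close> only, then \<open>u - p\<close> has a strict minimum at \<open>x0\<close> and exceeds it by some
  \<open>\<eta> > 0\<close> on the frontier of \<open>U\<close>. A function closer than \<open>\<eta> / 2\<close> to \<open>u\<close> still attains its minimum over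
  the closure, after subtraction of \<open>p\<close>, inside \<open>U\<close>; by convexity this local minimum is global.\<close>

lemma strict_subgradient_persists:
  fixes u :: "real ^ 'n \<Rightarrow> real"
  assumes "open U" "compact (closure U)" "closure U \<subseteq> D" "continuous_on D u"
    and "x0 \<in> U" "p \<in> subdifferential D u x0"
    and uniq: "\<And>x. x \<in> D \<Longrightarrow> p \<in> subdifferential D u x \<Longrightarrow> x = x0"
  obtains e where "e > 0"
    "\<And>D' v. convex_on D' v \<Longrightarrow> closure U \<subseteq> D' \<Longrightarrow> continuous_on (closure U) v \<Longrightarrow>
       (\<And>x. x \<in> closure U \<Longrightarrow> \<bar>v x - u x\<bar> < e) \<Longrightarrow> p \<in> (\<Union>x\<in>U. subdifferential D' v x)"
proof -
  define w where "w x = u x - p \<bullet> x" for x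
  have wmin: "w x0 \<le> w y" if "y \<in> D" for y
    using assms(6) that by (force simp: subdifferential_def w_def inner_diff_right)
  have strict: "w x0 < w y" if "y \<in> D" "y \<noteq> x0" for y
  proof (rule ccontr)
    assume "\<not> w x0 < w y"
    then have "w y \<le> w z" if "z \<in> D" for z using wmin[OF that] by simp
    then have "p \<in> subdifferential D u y"
      by (force simp: subdifferential_def w_def inner_diff_right)
    then show False using uniq that by blast
  qed
  have "\<exists>\<eta>>0. \<forall>x\<in>frontier U. w x0 + \<eta> \<le> w x"
  proof (cases "frontier U = {}")
    case True
    then show ?thesis by (intro exI[of _ 1]) auto
  next
    case False
    have sub: "frontier U \<subseteq> closure U" by (auto simp: frontier_def)
    have "compact (frontier U)"
      unfolding frontier_def by (rule compact_diff[OF assms(2) open_interior])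
    moreover have "continuous_on (frontier U) w"
      unfolding w_def using assms(3,4) sub
      by (intro continuous_intros) (blast intro: continuous_on_subset)
    ultimately obtain z where z: "z \<in> frontier U" "\<forall>y\<in>frontier U. w z \<le> w y"
      using continuous_attains_inf[OF _ False] by blast
    have "z \<noteq> x0" using z(1) assms(1,5) by (auto simp: frontier_def interior_open)
    moreover have "z \<in> D" using z(1) sub assms(3) by blast
    ultimately have "w x0 < w z" by (rule strict[rotated])
    with z(2) show ?thesis by (intro exI[of _ "w z - w x0"]) auto
  qed
  then obtain \<eta> where \<eta>: "\<eta> > 0" "\<And>x. x \<in> frontier U \<Longrightarrow> w x0 + \<eta> \<le> w x" by blast
  show ?thesis
  proof (rule that[of "\<eta> / 2"])
    fix D' v
    assume v: "convex_on D' v" "closure U \<subseteq> D'" "continuous_on (closure U) v"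
      and close: "\<And>x. x \<in> closure U \<Longrightarrow> \<bar>v x - u x\<bar> < \<eta> / 2"
    define g where "g x = v x - p \<bullet> x" for x
    have x0: "x0 \<in> closure U" using assms(5) closure_subset by blast
    have "continuous_on (closure U) g" unfolding g_def using v(3) by (intro continuous_intros)
    from continuous_attains_inf[OF assms(2) _ this] x0
    obtain z where z: "z \<in> closure U" "\<forall>y\<in>closure U. g z \<le> g y" by (metis empty_iff)
    have "z \<in> U"
    proof (rule ccontr)
      assume "z \<notin> U"
      then have "z \<in> frontier U" using z(1) assms(1) by (simp add: frontier_def interior_open)
      then have "w x0 + \<eta> \<le> w z" by (rule \<eta>(2))
      moreover have "g z \<le> g x0" using z(2) x0 by blast
      moreover have "\<bar>v z - u z\<bar> < \<eta> / 2" "\<bar>v x0 - u x0\<bar> < \<eta> / 2" using close z(1) x0 by auto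
      ultimately show False unfolding g_def w_def by linarith
    qed
    then obtain r where r: "r > 0" "ball z r \<subseteq> U" using assms(1) open_contains_ball by blast
    have "convex_on D' g"
    proof -
      have "convex_on D' (\<lambda>x. - (p \<bullet> x))"
        using convex_on_imp_convex[OF v(1)]
        by (intro convex_onI) (auto simp: inner_add_right algebra_simps)
      from convex_on_add[OF v(1) this] show ?thesis by (simp add: g_def[abs_def])
    qed
    moreover have "ball z r \<subseteq> D'" using r(2) v(2) closure_subset by blast
    moreover have "\<forall>y\<in>ball z r. g z \<le> g y" using r(2) z(2) closure_subset by blast
    ultimately have "\<forall>y\<in>D'. g z \<le> g y"
      using convex_local_global_minimum[OF r(1)] by blast
    then have "p \<in> subdifferential D' v z"
      by (force simp: subdifferential_def g_def inner_diff_right)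
    then show "p \<in> (\<Union>x\<in>U. subdifferential D' v x)" using \<open>z \<in> U\<close> by blast
  qed (use \<eta> in auto)
qed

text \<open>Weak convergence of Monge-Ampere measures. For a compact set \<open>K\<close>, both inequalities between the
  measure of its subgradient image and the integral of \<open>f\<close> over \<open>K\<close> come from set inclusions. Limits of
  subgradients of the approximants over \<open>K\<close> are subgradients of \<open>u\<close> over \<open>K\<close>, which bounds the image
  from below. Almost every subgradient of \<open>u\<close> over \<open>K\<close> belongs to a single point, so it persists
  for the approximants over any neighbourhood \<open>U\<close> of \<open>K\<close>, which bounds the image from above by
  the integral over \<open>U\<close>; then \<open>U\<close> shrinks to \<open>K\<close>. Borel sets follow by regularity.\<close>

theorem aleksandrov_solution_limit:
  fixes u f :: "real ^ 'n \<Rightarrow> real" and D' :: "nat \<Rightarrow> (real ^ 'n) set"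
  assumes D: "open D" "bounded D" and u: "convex_on D u"
    and f: "continuous_on D f" "\<And>x. x \<in> D \<Longrightarrow> 0 \<le> f x" "\<And>x. x \<in> D \<Longrightarrow> f x \<le> B"
    and D': "\<And>m. open (D' m)" "\<And>m. convex_on (D' m) (v m)"
    and sol: "\<And>m. aleksandrov_solution (D' m) (v m) (g m)"
    and sub: "\<And>K. compact K \<Longrightarrow> K \<subseteq> D \<Longrightarrow> \<forall>\<^sub>F m in sequentially. K \<subseteq> D' m"
    and lim_v: "\<And>K. compact K \<Longrightarrow> K \<subseteq> D \<Longrightarrow> uniform_limit K v u sequentially"
    and lim_g: "\<And>K. compact K \<Longrightarrow> K \<subseteq> D \<Longrightarrow> uniform_limit K g f sequentially"
  shows "aleksandrov_solution D u f"
proof -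
  define h where "h x = indicator D x *\<^sub>R f x" for x
  have h_meas[measurable]: "h \<in> borel_measurable borel"
    unfolding h_def using D(1) f(1) by (intro borel_measurable_continuous_on_indicator) auto
  define \<nu> where "\<nu> = density lborel (\<lambda>x. ennreal (h x))"
  have sets_\<nu>[simp]: "sets \<nu> = sets borel" "space \<nu> = UNIV" by (auto simp: \<nu>_def)
  have \<nu>: "emeasure \<nu> E = (\<integral>\<^sup>+x\<in>E. ennreal (f x) \<partial>lebesgue)" if "E \<in> sets borel" "E \<subseteq> D" for E
  proof -
    have "emeasure \<nu> E = (\<integral>\<^sup>+x. ennreal (h x) * indicator E x \<partial>lborel)"
      unfolding \<nu>_def using that by (intro emeasure_density) auto
    also have "\<dots> = (\<integral>\<^sup>+x. ennreal (h x) * indicator E x \<partial>lebesgue)"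
      by (simp add: nn_integral_completion)
    also have "\<dots> = (\<integral>\<^sup>+x\<in>E. ennreal (f x) \<partial>lebesgue)"
      using that(2) by (intro nn_integral_cong) (auto simp: h_def indicator_def)
    finally show ?thesis .
  qed
  have fin: "emeasure \<nu> (space \<nu>) \<noteq> \<infinity>"
  proof -
    have "emeasure \<nu> (space \<nu>) = (\<integral>\<^sup>+x. ennreal (h x) \<partial>lborel)"
      by (simp add: \<nu>_def emeasure_density)
    also have "\<dots> \<le> (\<integral>\<^sup>+x. ennreal B * indicator D x \<partial>lborel)"
      using f(3) by (intro nn_integral_mono) (auto simp: h_def indicator_def intro: ennreal_leI)
    also have "\<dots> = ennreal B * emeasure lborel D"
      using D(1) by (simp add: nn_integral_cmult_indicator)
    also have "\<dots> < \<infinity>"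
      using emeasure_bounded_finite[OF D(2)] by (simp add: ennreal_mult_less_top)
    finally show ?thesis by simp
  qed
  define P where "P m A = (\<Union>x\<in>A. subdifferential (D' m) (v m) x)" for m A
  define Q where "Q A = (\<Union>x\<in>A. subdifferential D u x)" for A
  have P_meas: "P m E \<in> sets lebesgue" "emeasure lebesgue (P m E) = (\<integral>\<^sup>+x\<in>E. ennreal (g m x) \<partial>lebesgue)"
    if "E \<in> sets borel" "E \<subseteq> D' m" for m E
    using sol[of m] that by (auto simp: aleksandrov_solution_def P_def)
  have cont_u: "continuous_on D u" by (rule convex_on_continuous[OF D(1) u])
  have ptwise: "(\<lambda>m. v m y) \<longlonglongrightarrow> u y" if "y \<in> D" for y
    using lim_v[of "{y}"] that by (auto intro: tendsto_uniform_limitI)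
  have \<nu>_le: "emeasure \<nu> E \<le> (\<integral>\<^sup>+x\<in>E. ennreal (k x) \<partial>lebesgue) + ennreal e * emeasure lebesgue E"
    if "E \<in> sets borel" "E \<subseteq> D" "0 < e" "\<And>x. x \<in> E \<Longrightarrow> f x \<le> k x + e" for E k e
  proof -
    have "emeasure \<nu> E = (\<integral>\<^sup>+x. ennreal (h x) * indicator E x \<partial>lborel)"
      unfolding \<nu>_def using that(1) by (intro emeasure_density) auto
    also have "\<dots> \<le> (\<integral>\<^sup>+x. ennreal (h x - e) * indicator E x + ennreal e * indicator E x \<partial>lborel)"
    proof (intro nn_integral_mono)
      fix x
      have "ennreal (h x) \<le> ennreal (max 0 (h x - e) + e)" by (intro ennreal_leI) simp
      also have "\<dots> = ennreal (h x - e) + ennreal e"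
        using \<open>0 < e\<close> by (subst ennreal_plus) (auto simp: ennreal_max_0)
      finally show "ennreal (h x) * indicator E x \<le>
          ennreal (h x - e) * indicator E x + ennreal e * indicator E x"
        by (simp add: indicator_def)
    qed
    also have "\<dots> = (\<integral>\<^sup>+x. ennreal (h x - e) * indicator E x \<partial>lborel) + ennreal e * emeasure lborel E"
      using that(1) by (subst nn_integral_add) (auto simp: nn_integral_cmult_indicator)
    also have "\<dots> \<le> (\<integral>\<^sup>+x\<in>E. ennreal (k x) \<partial>lborel) + ennreal e * emeasure lborel E"
    proof (intro add_right_mono nn_integral_mono)
      fix x
      show "ennreal (h x - e) * indicator E x \<le> ennreal (k x) * indicator E x"
        using that(2) that(4)[of x] by (auto simp: indicator_def h_def intro!: ennreal_leI)
    qed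
    finally show ?thesis using that(1) by (simp add: nn_integral_completion)
  qed
  have le_\<nu>: "(\<integral>\<^sup>+x\<in>E. ennreal (k x) \<partial>lebesgue) \<le> emeasure \<nu> E + ennreal e * emeasure lebesgue E"
    if "E \<in> sets borel" "E \<subseteq> D" "0 < e" "\<And>x. x \<in> E \<Longrightarrow> k x \<le> f x + e" for E k e
  proof -
    have "(\<integral>\<^sup>+x\<in>E. ennreal (k x) \<partial>lebesgue) = (\<integral>\<^sup>+x\<in>E. ennreal (k x) \<partial>lborel)"
      by (simp add: nn_integral_completion)
    also have "\<dots> \<le> (\<integral>\<^sup>+x. ennreal (h x) * indicator E x + ennreal e * indicator E x \<partial>lborel)"
    proof (intro nn_integral_mono)
      fix x
      show "ennreal (k x) * indicator E x \<le> ennreal (h x) * indicator E x + ennreal e * indicator E x"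
        using that(2) that(4)[of x] f(2)[of x] \<open>0 < e\<close>
        by (auto simp: indicator_def h_def simp flip: ennreal_plus intro!: ennreal_leI)
    qed
    also have "\<dots> = (\<integral>\<^sup>+x. ennreal (h x) * indicator E x \<partial>lborel) + ennreal e * emeasure lborel E"
      using that(1) by (subst nn_integral_add) (auto simp: nn_integral_cmult_indicator)
    also have "(\<integral>\<^sup>+x. ennreal (h x) * indicator E x \<partial>lborel) = emeasure \<nu> E"
      unfolding \<nu>_def using that(1) by (intro emeasure_density[symmetric]) auto
    finally show ?thesis using that(1) by simp
  qed
  \<comment> \<open>a uniform error on a bounded set contributes in proportion to its finite measure\<close>
  have le_eps: "a \<le> b" if *: "\<And>e. 0 < e \<Longrightarrow> a \<le> b + ennreal e * emeasure lebesgue E"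
      and E: "bounded E" "E \<in> sets borel" for a b :: ennreal and E :: "(real^'n) set"
  proof (rule ennreal_le_epsilon)
    fix e :: real assume "e > 0"
    have "emeasure lebesgue E < \<infinity>" using emeasure_bounded_finite[OF E(1)] E(2) by simp
    then obtain c where c: "c \<ge> 0" "emeasure lebesgue E = ennreal c"
      by (cases "emeasure lebesgue E") auto
    have "a \<le> b + ennreal (e / (c + 1)) * ennreal c"
      using *[of "e / (c + 1)"] \<open>e > 0\<close> c by simp
    also have "ennreal (e / (c + 1)) * ennreal c = ennreal (e / (c + 1) * c)"
      using c(1) \<open>e > 0\<close> by (intro ennreal_mult[symmetric]) auto
    also have "b + ennreal (e / (c + 1) * c) \<le> b + ennreal e"
      using c(1) \<open>e > 0\<close> by (intro add_left_mono ennreal_leI) (simp add: field_simps)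
    finally show "a \<le> b + ennreal e" .
  qed
  have close_g: "\<forall>\<^sub>F m in sequentially. \<forall>x\<in>K. f x \<le> g m x + e \<and> g m x \<le> f x + e"
    if "compact K" "K \<subseteq> D" "0 < e" for K e
    using uniform_limitD[OF lim_g[OF that(1,2)] that(3)]
    by eventually_elim (force simp: dist_real_def)

  have lower: "emeasure \<nu> K \<le> emeasure lebesgue (Q K)" if K: "compact K" "K \<subseteq> D" for K
  proof -
    obtain d C where C: "d > 0" "compact C" "C \<subseteq> D" "\<And>x. x \<in> K \<Longrightarrow> cball x d \<subseteq> C"
      using compact_enlargement[OF K(1) D(1) K(2)] by metis
    have KC: "K \<subseteq> C" using C(1,4) by force
    obtain M where M: "\<And>x. x \<in> C \<Longrightarrow> \<bar>u x\<bar> \<le> M"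
      using compact_imp_bounded[OF compact_continuous_image[OF continuous_on_subset[OF cont_u C(3)] C(2)]]
      by (auto simp: bounded_iff)
    \<comment> \<open>The subgradients over \<open>K\<close> of all late approximants lie in one ball, so that the limit of
      the measures of their tails may be taken.\<close>
    have "\<forall>\<^sub>F m in sequentially. C \<subseteq> D' m \<and> P m K \<subseteq> cball 0 ((2 * M + 2) / d)"
      using sub[OF C(2,3)] uniform_limitD[OF lim_v[OF C(2,3)] zero_less_one]
    proof eventually_elim
      case (elim m)
      have "norm p \<le> (2 * M + 2) / d" if x: "x \<in> K" "p \<in> subdifferential (D' m) (v m) x" for p x
      proof (rule subgradient_norm_bound[OF x(2) _ C(1)])
        show "cball x d \<subseteq> D' m" using C(4)[OF x(1)] elim(1) by blast
        fix y assume "y \<in> cball x d"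
        then have "y \<in> C" "x \<in> C" using C(4)[OF x(1)] KC x(1) by blast+
        then have "\<bar>v m y - u y\<bar> < 1" "\<bar>v m x - u x\<bar> < 1" "\<bar>u y\<bar> \<le> M" "\<bar>u x\<bar> \<le> M"
          using elim(2) M by (auto simp: dist_real_def)
        then show "v m y - v m x \<le> 2 * M + 2" by linarith
      qed
      then show ?case using elim(1) by (auto simp: P_def)
    qed
    then obtain N0 where N0: "\<And>m. m \<ge> N0 \<Longrightarrow> C \<subseteq> D' m"
        "\<And>m. m \<ge> N0 \<Longrightarrow> P m K \<subseteq> cball 0 ((2 * M + 2) / d)"
      unfolding eventually_sequentially by blast
    have K_borel: "K \<in> sets borel" using K(1) by (rule borel_compact)
    define A where "A N = (\<Union>m\<in>{N0 + N..}. P m K)" for N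
    have PK: "P m K \<in> sets lebesgue" "emeasure lebesgue (P m K) = (\<integral>\<^sup>+x\<in>K. ennreal (g m x) \<partial>lebesgue)"
      if "m \<ge> N0" for m
      using P_meas[OF K_borel, of m] N0(1)[OF that] KC by auto
    have A_meas: "A N \<in> sets lebesgue" for N
      unfolding A_def using PK(1) by (intro sets.countable_UN') auto
    have A_dec: "decseq A"
      unfolding decseq_def A_def by (intro allI impI UN_mono) auto
    have A_fin: "emeasure lebesgue (A N) \<noteq> \<infinity>" for N
    proof -
      have "emeasure lebesgue (A N) \<le> emeasure lebesgue (cball 0 ((2 * M + 2) / d) :: (real^'n) set)"
        using N0(2) unfolding A_def by (intro emeasure_mono UN_least) auto
      also have "\<dots> < \<infinity>" using emeasure_bounded_finite[OF bounded_cball] by simp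
      finally show ?thesis by simp
    qed
    have "emeasure \<nu> K \<le> emeasure lebesgue (A N)" for N
    proof (rule le_eps[OF _ compact_imp_bounded[OF K(1)] K_borel])
      fix e :: real assume "e > 0"
      then obtain m where m: "m \<ge> N0 + N" "\<And>x. x \<in> K \<Longrightarrow> f x \<le> g m x + e"
        using close_g[OF K \<open>e > 0\<close>] unfolding eventually_sequentially by (meson nle_le)
      have "emeasure \<nu> K \<le> emeasure lebesgue (P m K) + ennreal e * emeasure lebesgue K"
        using \<nu>_le[OF K_borel K(2) \<open>e > 0\<close> m(2)] PK(2)[of m] m(1) by simp
      also have "\<dots> \<le> emeasure lebesgue (A N) + ennreal e * emeasure lebesgue K"
        using m(1) A_meas by (intro add_right_mono emeasure_mono) (auto simp: A_def)
      finally show "emeasure \<nu> K \<le> emeasure lebesgue (A N) + ennreal e * emeasure lebesgue K" .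
    qed
    then have "emeasure \<nu> K \<le> (INF N. emeasure lebesgue (A N))" by (intro INF_greatest)
    also have "\<dots> = emeasure lebesgue (\<Inter>N. A N)"
      using A_meas A_fin A_dec by (intro INF_emeasure_decseq) auto
    also have "\<dots> \<le> emeasure lebesgue (Q K)"
    proof (rule emeasure_mono)
      show "Q K \<in> sets lebesgue"
        using compact_subdifferential_image[OF D(1) u K]
        by (auto simp: Q_def intro: lmeasurable_compact fmeasurableD)
      show "(\<Inter>N. A N) \<subseteq> Q K"
      proof
        fix p assume "p \<in> (\<Inter>N. A N)"
        then have "\<forall>N. \<exists>m x. m \<ge> N0 + N \<and> x \<in> K \<and> p \<in> subdifferential (D' m) (v m) x"
          by (force simp: A_def P_def)
        then obtain m x where mx: "\<And>N. m N \<ge> N0 + N" "\<And>N. x N \<in> K"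
            "\<And>N. p \<in> subdifferential (D' (m N)) (v (m N)) (x N)"
          by metis
        obtain a r where a: "a \<in> K" "strict_mono (r :: nat \<Rightarrow> nat)" "(x \<circ> r) \<longlonglongrightarrow> a"
          using K(1) mx(2) compact_def by blast
        have "m (r k) \<ge> k" for k
          using mx(1)[of "r k"] seq_suble[OF a(2), of k] by linarith
        then have mr: "filterlim (\<lambda>k. m (r k)) sequentially sequentially"
          by (intro filterlim_at_top_mono[OF filterlim_ident]) auto
        have "p \<in> subdifferential D u a"
        proof (rule subdifferential_limit[where x="x \<circ> r" and p="\<lambda>_. p"
              and D="\<lambda>k. D' (m (r k))" and v="\<lambda>k. v (m (r k))"])
          show "(\<lambda>k. v (m (r k)) ((x \<circ> r) k)) \<longlonglongrightarrow> u a"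
          proof -
            have "(\<lambda>k. u ((x \<circ> r) k)) \<longlonglongrightarrow> u a"
            proof (rule continuous_on_tendsto_compose[OF cont_u a(3)])
              show "a \<in> D" using a(1) K(2) by blast
              show "\<forall>\<^sub>F k in sequentially. (x \<circ> r) k \<in> D"
                using mx(2) K(2) by (auto intro: always_eventually)
            qed
            moreover have "(\<lambda>k. v (m (r k)) ((x \<circ> r) k) - u ((x \<circ> r) k)) \<longlonglongrightarrow> 0"
            proof (rule tendstoI)
              fix e :: real assume "e > 0"
              have "\<forall>\<^sub>F k in sequentially. \<forall>y\<in>K. dist (v (m (r k)) y) (u y) < e"
                using eventually_compose_filterlim[OF uniform_limitD[OF lim_v[OF K] \<open>e > 0\<close>] mr] .
              then show "\<forall>\<^sub>F k in sequentially. dist (v (m (r k)) ((x \<circ> r) k) - u ((x \<circ> r) k)) 0 < e"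
                by eventually_elim (use mx(2) in \<open>auto simp: dist_real_def\<close>)
            qed
            ultimately show ?thesis using tendsto_add by fastforce
          qed
          show "\<forall>\<^sub>F k in sequentially. y \<in> D' (m (r k))" if "y \<in> D" for y
            using eventually_compose_filterlim[OF sub[of "{y}"] mr] that by simp
          show "(\<lambda>k. v (m (r k)) y) \<longlonglongrightarrow> u y" if "y \<in> D" for y
            using filterlim_compose[OF ptwise[OF that] mr] .
        qed (use mx a in auto)
        then show "p \<in> Q K" using a(1) by (auto simp: Q_def)
      qed
    qed
    finally show ?thesis .
  qed

  have upper: "emeasure lebesgue (Q K) \<le> emeasure \<nu> K" if K: "compact K" "K \<subseteq> D" for K
  proof -
    \<comment> \<open>slopes attained at several points are discarded; this costs nothing in measure\<close>
    define N where "N = {p. \<exists>x\<in>D. \<exists>y\<in>D. x \<noteq> y \<and> p \<in> subdifferential D u x \<and> p \<in> subdifferential D u y}"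
    have N: "N \<in> null_sets lebesgue"
      using negligible_common_subgradients[OF D(1) u] by (simp add: N_def negligible_iff_null_sets)
    have "emeasure lebesgue (Q K) \<le> emeasure \<nu> V" if V: "K \<subseteq> V" "open V" for V
    proof -
      obtain d C where C: "d > 0" "compact C" "C \<subseteq> V \<inter> D" "\<And>x. x \<in> K \<Longrightarrow> cball x d \<subseteq> C"
        using compact_enlargement[OF K(1) open_Int[OF V(2) D(1)]] V(1) K(2) by (metis Int_subset_iff)
      define U where "U = (\<Union>x\<in>K. ball x d)"
      have U: "open U" "K \<subseteq> U" "U \<subseteq> C"
        using C(1,4) ball_subset_cball by (force simp: U_def)+
      then have clU: "closure U \<subseteq> C" "compact (closure U)"
        using C(2) by (auto simp: closure_minimal compact_imp_closed compact_closure
            intro: bounded_subset[OF compact_imp_bounded])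
      have UD: "U \<subseteq> D" "closure U \<subseteq> D" using clU(1) U(3) C(3) by auto
      have U_borel: "U \<in> sets borel" using U(1) by simp
      show ?thesis
      proof (rule le_eps[OF _ bounded_subset[OF D(2) UD(1)] U_borel])
        fix e :: real assume "e > 0"
        have "\<forall>\<^sub>F m in sequentially. closure U \<subseteq> D' m \<and> (\<forall>x\<in>closure U. g m x \<le> f x + e)"
          using sub[OF clU(2) UD(2)] close_g[OF clU(2) UD(2) \<open>e > 0\<close>] by eventually_elim auto
        then obtain M where M: "\<And>m. m \<ge> M \<Longrightarrow> closure U \<subseteq> D' m"
            "\<And>m x. m \<ge> M \<Longrightarrow> x \<in> closure U \<Longrightarrow> g m x \<le> f x + e"
          unfolding eventually_sequentially by blast
        have PU: "P m U \<in> sets lebesgue" "emeasure lebesgue (P m U) \<le> emeasure \<nu> U + ennreal e * emeasure lebesgue U"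
          if "m \<ge> M" for m
        proof -
          have "U \<subseteq> D' m" using M(1)[OF that] closure_subset by blast
          then show "P m U \<in> sets lebesgue" by (rule P_meas[OF U_borel])
          have "(\<integral>\<^sup>+x\<in>U. ennreal (g m x) \<partial>lebesgue) \<le> emeasure \<nu> U + ennreal e * emeasure lebesgue U"
            using M(2)[OF that] closure_subset[of U] by (intro le_\<nu>[OF U_borel UD(1) \<open>e > 0\<close>]) blast
          then show "emeasure lebesgue (P m U) \<le> emeasure \<nu> U + ennreal e * emeasure lebesgue U"
            using P_meas(2)[OF U_borel \<open>U \<subseteq> D' m\<close>] by simp
        qed
        define B where "B j = (\<Inter>m\<in>{M + j..}. P m U)" for j
        have B_meas: "B j \<in> sets lebesgue" for j
          unfolding B_def using PU(1) by (intro sets.countable_INT') auto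
        have B_inc: "incseq B"
          unfolding incseq_def B_def by (intro allI impI INF_superset_mono) auto
        have B_le: "emeasure lebesgue (B j) \<le> emeasure \<nu> U + ennreal e * emeasure lebesgue U" for j
        proof -
          have "emeasure lebesgue (B j) \<le> emeasure lebesgue (P (M + j) U)"
            using PU(1) by (intro emeasure_mono) (auto simp: B_def)
          also have "\<dots> \<le> emeasure \<nu> U + ennreal e * emeasure lebesgue U" by (rule PU(2)) simp
          finally show ?thesis .
        qed
        have "Q K \<subseteq> (\<Union>j. B j) \<union> N"
        proof
          fix p assume "p \<in> Q K"
          then obtain x0 where x0: "x0 \<in> K" "p \<in> subdifferential D u x0" by (auto simp: Q_def)
          show "p \<in> (\<Union>j. B j) \<union> N"
          proof (cases "p \<in> N")
            case False
            then have uniq: "x = x0" if "x \<in> D" "p \<in> subdifferential D u x" for x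
              using that x0 K(2) by (auto simp: N_def)
            obtain \<epsilon> where \<epsilon>: "\<epsilon> > 0"
              "\<And>D' v. convex_on D' v \<Longrightarrow> closure U \<subseteq> D' \<Longrightarrow> continuous_on (closure U) v \<Longrightarrow>
                (\<And>x. x \<in> closure U \<Longrightarrow> \<bar>v x - u x\<bar> < \<epsilon>) \<Longrightarrow> p \<in> (\<Union>x\<in>U. subdifferential D' v x)"
              using strict_subgradient_persists[OF U(1) clU(2) UD(2) cont_u _ x0(2) uniq] x0(1) U(2) by blast
            have "\<forall>\<^sub>F m in sequentially. p \<in> P m U"
              using sub[OF clU(2) UD(2)] uniform_limitD[OF lim_v[OF clU(2) UD(2)] \<epsilon>(1)]
            proof eventually_elim
              case (elim m)
              then show ?case
                unfolding P_def
                by (intro \<epsilon>(2) D'(2) continuous_on_subset[OF convex_on_continuous[OF D']])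
                   (auto simp: dist_real_def)
            qed
            then obtain j where "\<And>m. m \<ge> j \<Longrightarrow> p \<in> P m U" unfolding eventually_sequentially by blast
            then have "p \<in> B j" by (simp add: B_def)
            then show ?thesis by blast
          qed simp
        qed
        then have "emeasure lebesgue (Q K) \<le> emeasure lebesgue ((\<Union>j. B j) \<union> N)"
          using B_meas N by (intro emeasure_mono) auto
        also have "\<dots> = emeasure lebesgue (\<Union>j. B j)"
          using B_meas N by (intro emeasure_Un_null_set) auto
        also have "\<dots> = (SUP j. emeasure lebesgue (B j))"
          using B_meas B_inc by (intro SUP_emeasure_incseq[symmetric]) auto
        also have "\<dots> \<le> emeasure \<nu> U + ennreal e * emeasure lebesgue U"
          using B_le by (intro SUP_least)
        also have "\<dots> \<le> emeasure \<nu> V + ennreal e * emeasure lebesgue U"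
          using U(3) C(3) V(2) by (intro add_right_mono emeasure_mono) auto
        finally show "emeasure lebesgue (Q K) \<le> emeasure \<nu> V + ennreal e * emeasure lebesgue U" .
      qed
    qed
    then show ?thesis
      unfolding outer_regular[OF sets_\<nu>(1) fin borel_compact[OF K(1)]] by (intro INF_greatest) auto
  qed

  have cpt: "(\<Union>x\<in>K. subdifferential D u x) \<in> sets lebesgue \<and>
      emeasure lebesgue (\<Union>x\<in>K. subdifferential D u x) = emeasure \<nu> K"
    if "compact K" "K \<subseteq> D" for K
    using compact_subdifferential_image[OF D(1) u that] lower[OF that] upper[OF that]
    by (auto simp: Q_def intro: lmeasurable_compact fmeasurableD antisym)
  show ?thesis
    unfolding aleksandrov_solution_def
  proof (intro ballI impI)
    fix E :: "(real^'n) set" assume E: "E \<in> sets borel" "E \<subseteq> D"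
    show "(\<Union>x\<in>E. subdifferential D u x) \<in> sets lebesgue \<and>
        emeasure lebesgue (\<Union>x\<in>E. subdifferential D u x) = (\<integral>\<^sup>+x\<in>E. ennreal (f x) \<partial>lebesgue)"
      unfolding \<nu>[OF E, symmetric] by (rule emeasure_image_of_compacts[OF sets_\<nu>(1) fin D(1) cpt E])
  qed
qed


section \<open>Uniform estimates for normalized eigenfunctions\<close>

lemma convex_on_closure:
  fixes f :: "'a::real_normed_vector \<Rightarrow> real"
  assumes "convex_on D f" "continuous_on (closure D) f"
  shows "convex_on (closure D) f"
proof (rule convex_onI)
  show "convex (closure D)" by (rule convex_closure[OF convex_on_imp_convex[OF assms(1)]])
  fix t :: real and x y
  assume t: "0 < t" "t < 1" and xy: "x \<in> closure D" "y \<in> closure D"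
  obtain a where a: "\<And>n. a n \<in> D" "a \<longlonglongrightarrow> x" using xy(1) closure_sequential by blast
  obtain b where b: "\<And>n. b n \<in> D" "b \<longlonglongrightarrow> y" using xy(2) closure_sequential by blast
  let ?c = "\<lambda>n. (1 - t) *\<^sub>R a n + t *\<^sub>R b n" and ?z = "(1 - t) *\<^sub>R x + t *\<^sub>R y"
  have conv: "convex D" by (rule convex_on_imp_convex[OF assms(1)])
  have c: "?c n \<in> D" for n using convexD_alt[OF conv a(1) b(1)] t by simp
  have lim: "(\<lambda>n. f (s n)) \<longlonglongrightarrow> f z" if "\<And>n. s n \<in> D" "s \<longlonglongrightarrow> z" for s z
  proof (rule continuous_on_tendsto_compose[OF assms(2) that(2)])
    show "z \<in> closure D" using that closure_sequential by blast
    show "\<forall>\<^sub>F n in sequentially. s n \<in> closure D"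
      using that(1) closure_subset by (auto intro!: always_eventually)
  qed
  have "?c \<longlonglongrightarrow> ?z" using a(2) b(2) by (intro tendsto_intros)
  then have "(\<lambda>n. f (?c n)) \<longlonglongrightarrow> f ?z" using lim[of ?c ?z] c by blast
  moreover have "(\<lambda>n. (1 - t) * f (a n) + t * f (b n)) \<longlonglongrightarrow> (1 - t) * f x + t * f y"
    using lim a b by (intro tendsto_intros) auto
  ultimately show "f ?z \<le> (1 - t) * f x + t * f y"
    using convex_onD[OF assms(1), of t] a(1) b(1) t by (intro LIMSEQ_le) auto
qed

text \<open>The closure is the convex hull of its frontier, and a convex function on a convex hull is bounded
  by its values on the generating set.\<close>

lemma convex_nonpos_of_boundary:
  fixes f :: "'a::euclidean_space \<Rightarrow> real"
  assumes "bounded D" "convex_on D f" "continuous_on (closure D) f" "\<And>x. x \<in> frontier D \<Longrightarrow> f x \<le> 0"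
    and "x \<in> closure D"
  shows "f x \<le> 0"
proof -
  have "convex D" by (rule convex_on_imp_convex[OF assms(2)])
  have hull: "closure D = convex hull frontier (closure D)"
    using Krein_Milman_frontier[of "closure D"] \<open>convex D\<close> assms(1) by (simp add: convex_closure)
  have fr: "frontier (closure D) \<subseteq> frontier D"
    using interior_mono[OF closure_subset[of D]] by (auto simp: frontier_def)
  have "convex_on (convex hull frontier (closure D)) f"
    using convex_on_closure[OF assms(2,3)] hull by simp
  then have "\<forall>x\<in>convex hull frontier (closure D). f x \<le> 0"
    using fr assms(4) by (intro convex_on_convex_hull_bound) auto
  then show ?thesis using assms(5) hull by blast
qed

definition normalized_eigenpair :: "(real ^ 'n) set \<Rightarrow> real \<Rightarrow> (real ^ 'n \<Rightarrow> real) \<Rightarrow> bool" where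
  "normalized_eigenpair D l w \<longleftrightarrow>
     convex_domain D \<and> MA_eigenfunction D l w \<and> Linfty_norm D w = 1"

lemma normalized_eigenpairD:
  fixes D :: "(real ^ 'n) set"
  assumes "normalized_eigenpair D l w"
  shows "open D" "bounded D" "convex D" "D \<noteq> {}" "convex_on D w" "smooth_on D w"
    "continuous_on (closure D) w" "\<And>x. x \<in> frontier D \<Longrightarrow> w x = 0"
    "\<And>x. x \<in> D \<Longrightarrow> det (hessian w x) = l * \<bar>w x\<bar> ^ CARD('n)" "Linfty_norm D w = 1"
  using assms by (auto simp: normalized_eigenpair_def convex_domain_def MA_eigenfunction_def C11_closure_def)

text \<open>For a function continuous up to the boundary the essential supremum of the modulus is its
  maximum over the closure, because a nonempty open set is not negligible.\<close>

lemma eigenfunction_range: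
  assumes "normalized_eigenpair D l w"
  shows "x \<in> closure D \<Longrightarrow> - 1 \<le> w x" "x \<in> closure D \<Longrightarrow> w x \<le> 0" "\<exists>x0\<in>D. w x0 = - 1"
proof -
  note D = normalized_eigenpairD[OF assms]
  show nonpos: "w x \<le> 0" if "x \<in> closure D" for x
    using convex_nonpos_of_boundary[OF D(2,5,7) _ that] D(8) by simp
  have cont: "continuous_on D w" using D(7) closure_subset by (rule continuous_on_subset)
  have Dleb: "D \<in> sets lebesgue" using D(1) by simp
  have "AE x in lebesgue_on D. ereal \<bar>w x\<bar> \<le> 1"
    using esssup_AE[of "\<lambda>x. ereal \<bar>w x\<bar>" "lebesgue_on D"] D(10) by (simp add: Linfty_norm_def)
  then have ae: "AE x in lebesgue. x \<in> D \<longrightarrow> \<bar>w x\<bar> \<le> 1"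
    using Dleb by (simp add: AE_restrict_space_iff one_ereal_def)
  have le1: "\<bar>w x\<bar> \<le> 1" if "x \<in> D" for x
  proof (rule ccontr)
    assume "\<not> \<bar>w x\<bar> \<le> 1"
    let ?G = "{y \<in> D. 1 < \<bar>w y\<bar>}"
    have "open ?G"
      using continuous_open_preimage[of D "\<lambda>y. \<bar>w y\<bar>" "{1<..}"] cont D(1)
      by (auto simp: vimage_def Int_def conj_commute intro!: continuous_intros)
    moreover have "?G \<noteq> {}" using that \<open>\<not> \<bar>w x\<bar> \<le> 1\<close> by auto
    ultimately have "\<not> negligible ?G" by (rule open_not_negligible)
    moreover have "?G \<in> null_sets lebesgue"
      using ae AE_iff_null_sets[of ?G lebesgue] \<open>open ?G\<close>
      by (auto simp: not_less elim!: eventually_mono)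
    ultimately show False by (simp add: negligible_iff_null_sets)
  qed
  have "w x \<ge> - 1" if "x \<in> D" for x using le1[OF that] by (simp add: abs_le_iff)
  then show ge: "- 1 \<le> w x" if "x \<in> closure D" for x
    using that D(1,8) by (cases "x \<in> D") (auto simp: frontier_def interior_open)
  have "compact (closure D)" using D(2) by simp
  moreover have "closure D \<noteq> {}" using D(4) by simp
  moreover have "continuous_on (closure D) w" by (rule D(7))
  ultimately obtain z where z: "z \<in> closure D" "\<forall>y\<in>closure D. w z \<le> w y"
    using continuous_attains_inf by metis
  have "(1::ereal) \<le> ereal (- w z)"
  proof -
    have "esssup (lebesgue_on D) (\<lambda>x. ereal \<bar>w x\<bar>) \<le> ereal (- w z)"
    proof (rule esssup_I)
      show "(\<lambda>x. ereal \<bar>w x\<bar>) \<in> borel_measurable (lebesgue_on D)"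
        using continuous_imp_measurable_on_sets_lebesgue[OF cont Dleb] by measurable
      have "\<bar>w x\<bar> \<le> - w z" if "x \<in> D" for x
      proof -
        have "x \<in> closure D" using that closure_subset by blast
        then show ?thesis using z(2) nonpos by fastforce
      qed
      then show "AE x in lebesgue_on D. ereal \<bar>w x\<bar> \<le> ereal (- w z)"
        by (intro AE_I2) simp
    qed
    then show ?thesis using D(10) by (simp add: Linfty_norm_def)
  qed
  then have "w z = - 1" using ge[OF z(1)] by (simp add: one_ereal_def)
  moreover have "z \<in> D"
    using z(1) D(1) D(8)[of z] \<open>w z = - 1\<close> by (auto simp: frontier_def interior_open)
  ultimately show "\<exists>x0\<in>D. w x0 = - 1" by blast
qed

text \<open>Prolonging the segment from the minimum point \<open>x0\<close> through \<open>x\<close> by the factor \<open>1 + d / R\<close> stays in \<open>D\<close>,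
  and \<open>w\<close> is nonpositive at the far end; convexity along the segment gives the bound.\<close>

lemma convex_interior_decrease:
  fixes w :: "'a::euclidean_space \<Rightarrow> real"
  assumes "convex_on D w" "\<And>y. y \<in> D \<Longrightarrow> w y \<le> 0" "x0 \<in> D" "w x0 = - 1"
    and "cball x d \<subseteq> D" "0 < d" "norm (x - x0) \<le> R" "0 < R"
  shows "w x \<le> - (d / (R + d))"
proof -
  define s where "s = d / R"
  have s: "s > 0" using assms(6,8) by (simp add: s_def)
  let ?z = "x + s *\<^sub>R (x - x0)" and ?t = "s / (1 + s)"
  have "norm (s *\<^sub>R (x - x0)) \<le> s * R" using s assms(7) by simp
  then have z: "?z \<in> D" using assms(5,8) by (auto simp: s_def dist_norm)
  have "1 - ?t = 1 / (1 + s)" using s by (simp add: field_simps)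
  then have "(1 - ?t) *\<^sub>R ?z + ?t *\<^sub>R x0 = (1 / (1 + s)) *\<^sub>R (?z + s *\<^sub>R x0)"
    by (simp add: scaleR_add_right)
  also have "?z + s *\<^sub>R x0 = (1 + s) *\<^sub>R x" by (simp add: algebra_simps)
  finally have x: "(1 - ?t) *\<^sub>R ?z + ?t *\<^sub>R x0 = x" using s by simp
  have t: "0 \<le> ?t" "?t \<le> 1" using s by auto
  have "w x \<le> (1 - ?t) * w ?z + ?t * w x0"
    using convex_onD[OF assms(1) t z assms(3)] x by simp
  also have "\<dots> \<le> - ?t"
    using assms(2)[OF z] t assms(4) by (simp add: mult_nonneg_nonpos)
  also have "?t = d / (R + d)" using assms(6,8) by (simp add: s_def field_simps)
  finally show ?thesis .
qed

lemma eigenfunction_neg: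
  assumes "normalized_eigenpair D l w" "x \<in> D"
  shows "w x < 0"
proof -
  note D = normalized_eigenpairD[OF assms(1)] and r = eigenfunction_range[OF assms(1)]
  obtain x0 where x0: "x0 \<in> D" "w x0 = - 1" using r(3) by blast
  obtain d where d: "d > 0" "cball x d \<subseteq> D" using D(1) assms(2) open_contains_cball by blast
  have "w x \<le> - (d / ((norm (x - x0) + 1) + d))"
    using r(2) closure_subset x0 d by (intro convex_interior_decrease[OF D(5)]) (auto simp: add_nonneg_pos)
  also have "\<dots> < 0" using d(1) by (simp add: add_nonneg_pos)
  finally show ?thesis .
qed

text \<open>The minimum of \<open>w\<close> is \<open>-1\<close>, whereas \<open>w\<close> vanishes on the boundary. Hence \<open>w - c |x - x0|\<^sup>2\<close> with small
  \<open>c > 0\<close> still attains its minimum at some interior point \<open>z\<close>, where a paraboloid of opening \<open>c\<close>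
  supports \<open>w\<close>. There the Hessian is nonsingular, so \<open>l |w z|\<^sup>n = det D\<^sup>2w(z) > 0\<close>.\<close>

lemma eigenvalue_pos:
  assumes "normalized_eigenpair D l w"
  shows "0 < l"
proof -
  note D = normalized_eigenpairD[OF assms] and r = eigenfunction_range[OF assms]
  obtain x0 where x0: "x0 \<in> D" "w x0 = - 1" using r(3) by blast
  obtain R where R: "R > 0" "\<And>x. x \<in> closure D \<Longrightarrow> norm (x - x0) \<le> R"
  proof -
    have "bounded ((\<lambda>x. x - x0) ` closure D)"
      using D(2) by (simp add: bounded_translation_minus bounded_closure)
    then show ?thesis using that by (auto simp: bounded_pos)
  qed
  \<comment> \<open>with this choice the paraboloid lowers boundary values by at most \<open>1 / 2\<close>, which keeps them above \<open>-1\<close>\<close>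
  define c where "c = 1 / (2 * R\<^sup>2)"
  have c: "c > 0" "c * R\<^sup>2 = 1 / 2" using R(1) by (simp_all add: c_def)
  define g where "g x = w x - c * (norm (x - x0))\<^sup>2" for x
  have x0': "x0 \<in> closure D" using x0(1) closure_subset by blast
  have "compact (closure D)" using D(2) by simp
  moreover have "continuous_on (closure D) g" unfolding g_def using D(7) by (intro continuous_intros)
  moreover have "closure D \<noteq> {}" using x0' by auto
  ultimately obtain z where z: "z \<in> closure D" "\<forall>y\<in>closure D. g z \<le> g y"
    using continuous_attains_inf by metis
  have "z \<in> D"
  proof (rule ccontr)
    assume "z \<notin> D"
    then have "w z = 0" using z(1) D(1,8) by (auto simp: frontier_def interior_open)
    moreover have "(norm (z - x0))\<^sup>2 \<le> R\<^sup>2" using R(2)[OF z(1)] by (intro power_mono) auto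
    then have "c * (norm (z - x0))\<^sup>2 \<le> 1 / 2" using c by (metis mult_left_mono less_imp_le)
    moreover have "g z \<le> g x0" using z(2) x0' by blast
    ultimately show False using x0(2) by (simp add: g_def)
  qed
  have "w z + (2 * c) *\<^sub>R (z - x0) \<bullet> (y - z) + c * (norm (y - z))\<^sup>2 \<le> w y" if "y \<in> D" for y
  proof -
    have "(norm ((y - z) + (z - x0)))\<^sup>2 = (norm (y - z))\<^sup>2 + 2 * ((y - z) \<bullet> (z - x0)) + (norm (z - x0))\<^sup>2"
      unfolding power2_norm_eq_inner inner_add_left inner_add_right by (simp add: inner_commute)
    then have "(norm (y - x0))\<^sup>2 = (norm (y - z))\<^sup>2 + 2 * ((y - z) \<bullet> (z - x0)) + (norm (z - x0))\<^sup>2"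
      by simp
    moreover have "g z \<le> g y" using z(2) that closure_subset by blast
    ultimately show ?thesis
      by (simp add: g_def distrib_left inner_commute[of "y - z"])
  qed
  then have form: "c * (norm h)\<^sup>2 \<le> h \<bullet> (transpose (hessian w z) *v h)" for h
    using c(1) by (intro hessian_form_lower_bound[OF D(1,5,6) \<open>z \<in> D\<close>, where p="(2 * c) *\<^sub>R (z - x0)"]) auto
  have "h = 0" if "transpose (hessian w z) *v h = 0" for h
    using form[of h] that c(1) by (simp add: mult_le_0_iff)
  then have "det (hessian w z) \<noteq> 0"
    using det_nonzero_iff_kernel[of "transpose (hessian w z)"] by (simp add: det_transpose del: transpose_matrix_vector)
  then have "0 < det (hessian w z)"
    using det_hessian_nonneg[OF D(1,5,6) \<open>z \<in> D\<close>] by simp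
  then have "0 < l * \<bar>w z\<bar> ^ CARD('a)" by (simp only: D(9)[OF \<open>z \<in> D\<close>])
  then show ?thesis by (simp add: zero_less_mult_iff)
qed

lemma eigenfunction_aleksandrov_solution:
  fixes D :: "(real ^ 'n) set"
  assumes "normalized_eigenpair D l w"
  shows "aleksandrov_solution D w (\<lambda>x. l * \<bar>w x\<bar> ^ CARD('n))"
  unfolding aleksandrov_solution_def
proof (intro ballI impI)
  note D = normalized_eigenpairD[OF assms] and r = eigenfunction_range[OF assms]
  fix E :: "(real ^ 'n) set" assume E: "E \<in> sets borel" "E \<subseteq> D"
  let ?f = "\<lambda>x. l * \<bar>w x\<bar> ^ CARD('n)"
  have l: "0 < l" by (rule eigenvalue_pos[OF assms])
  have cont: "continuous_on D w" using D(7) closure_subset by (rule continuous_on_subset)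
  have E_leb: "E \<in> sets lebesgue" using E(1) by simp
  define h where "h x = indicator E x *\<^sub>R ?f x" for x
  have h: "h \<in> borel_measurable borel" "\<And>x. 0 \<le> h x"
    unfolding h_def
    by (intro borel_measurable_continuous_on_indicator E continuous_intros continuous_on_subset[OF cont])
       (use l in simp)
  have "(\<integral>\<^sup>+x. ennreal (h x) \<partial>lborel) \<le> (\<integral>\<^sup>+x. ennreal l * indicator D x \<partial>lborel)"
  proof (intro nn_integral_mono)
    fix x
    have "\<bar>w x\<bar> ^ CARD('n) \<le> 1" if "x \<in> D"
      using r(1,2)[of x] that closure_subset[of D] by (intro power_le_one) auto
    then show "ennreal (h x) \<le> ennreal l * indicator D x"
      using E(2) l by (auto simp: h_def indicator_def intro!: ennreal_leI)
  qed
  also have "\<dots> = ennreal l * emeasure lborel D"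
    using D(1) by (simp add: nn_integral_cmult_indicator)
  also have "\<dots> < \<infinity>"
    using emeasure_bounded_finite[OF D(2)] by (simp add: ennreal_mult_less_top)
  finally have "h integrable_on UNIV" by (rule nn_integral_integrable_on[OF h])
  moreover have "h = (\<lambda>x. if x \<in> E then ?f x else 0)" by (auto simp: h_def)
  ultimately have "?f integrable_on E" by (simp only: integrable_restrict_UNIV)
  then obtain m where m: "(?f has_integral m) E" by (auto simp: integrable_on_def)
  then have m': "((\<lambda>x. det (hessian w x)) has_integral m) E"
    using D(9) E(2) by (intro has_integral_eq[OF _ m]) auto
  have "det (hessian w x) \<noteq> 0" if "x \<in> D" for x
    using D(9)[OF that] l eigenfunction_neg[OF assms that] by simp
  note M = measure_subdifferential_smooth[OF D(1,5,6) this E_leb E(2) m']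
  have "emeasure lebesgue (\<Union>x\<in>E. subdifferential D w x) = ennreal m"
    using M by (simp add: emeasure_eq_measure2)
  also have "\<dots> = (\<integral>\<^sup>+x\<in>E. ennreal (?f x) \<partial>lborel)"
    using l by (intro nn_integral_has_integral_lebesgue'[OF _ m, symmetric]) auto
  also have "\<dots> = (\<integral>\<^sup>+x\<in>E. ennreal (?f x) \<partial>lebesgue)" by (simp add: nn_integral_completion)
  finally show "(\<Union>x\<in>E. subdifferential D w x) \<in> sets lebesgue \<and>
      emeasure lebesgue (\<Union>x\<in>E. subdifferential D w x) = (\<integral>\<^sup>+x\<in>E. ennreal (?f x) \<partial>lebesgue)"
    using M(1) by auto
qed

text \<open>The hypothesis says that \<open>q\<close> is a slope at the vertex of the cone that has its vertex on the graph
  above \<open>x\<close> and vanishes on the boundary of \<open>D\<close>. The minimum of \<open>w - q\<close> over the closure is attained at an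
  interior point: boundary values do not lie below the value at \<open>x\<close>.\<close>

lemma slopes_in_subdifferential:
  fixes w :: "real ^ 'n \<Rightarrow> real"
  assumes "open D" "bounded D" "continuous_on (closure D) w" "\<And>x. x \<in> frontier D \<Longrightarrow> w x = 0"
    and "x \<in> D" and slope: "\<And>y. y \<in> D \<Longrightarrow> q \<bullet> (y - x) \<le> - w x"
  shows "q \<in> (\<Union>z\<in>D. subdifferential D w z)"
proof -
  define g where "g y = w y - q \<bullet> (y - x)" for y
  have "compact (closure D)" using assms(2) by simp
  moreover have "continuous_on (closure D) g" unfolding g_def using assms(3) by (intro continuous_intros)
  moreover have "closure D \<noteq> {}" using assms(5) by auto
  ultimately obtain z where z: "z \<in> closure D" "\<forall>y\<in>closure D. g z \<le> g y"
    using continuous_attains_inf by metis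
  obtain z' where z': "z' \<in> D" "\<forall>y\<in>D. g z' \<le> g y"
  proof (cases "z \<in> D")
    case True
    then show ?thesis using that z(2) closure_subset by blast
  next
    case False
    then have wz: "w z = 0" using z(1) assms(1) assms(4)[of z] by (simp add: frontier_def interior_open)
    have "closure D \<subseteq> {y. q \<bullet> (y - x) \<le> - w x}"
      using slope by (intro closure_minimal) (auto intro!: closed_Collect_le continuous_intros)
    then have "g x \<le> g z" using z(1) wz by (auto simp: g_def)
    then have "\<forall>y\<in>D. g x \<le> g y" using z(2) closure_subset by fastforce
    then show ?thesis using that assms(5) by blast
  qed
  then have "q \<in> subdifferential D w z'"
    unfolding subdifferential_def g_def by (fastforce simp: inner_diff_right)
  then show ?thesis using z'(1) by blast
qed

text \<open>The total Monge-Ampere mass is the integral of \<open>l |w|\<^sup>n \<le> l\<close> over \<open>D\<close>.\<close>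

lemma subdifferential_mass_le:
  fixes D :: "(real ^ 'n) set"
  assumes "normalized_eigenpair D l w" "D \<subseteq> ball 0 R"
    and "T \<in> lmeasurable" "T \<subseteq> (\<Union>z\<in>D. subdifferential D w z)"
  shows "measure lebesgue T \<le> l * measure lebesgue (ball 0 R :: (real ^ 'n) set)"
proof -
  note D = normalized_eigenpairD[OF assms(1)] and r = eigenfunction_range[OF assms(1)]
  have l: "0 < l" by (rule eigenvalue_pos[OF assms(1)])
  have sol: "(\<Union>z\<in>D. subdifferential D w z) \<in> sets lebesgue"
    "emeasure lebesgue (\<Union>z\<in>D. subdifferential D w z)
      = (\<integral>\<^sup>+x\<in>D. ennreal (l * \<bar>w x\<bar> ^ CARD('n)) \<partial>lebesgue)"
    using eigenfunction_aleksandrov_solution[OF assms(1)] D(1) by (auto simp: aleksandrov_solution_def)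
  have "ennreal (measure lebesgue T) = emeasure lebesgue T"
    using assms(3) by (simp add: emeasure_eq_measure2)
  also have "\<dots> \<le> emeasure lebesgue (\<Union>z\<in>D. subdifferential D w z)"
    using sol(1) assms(4) by (intro emeasure_mono)
  also have "\<dots> \<le> (\<integral>\<^sup>+x. ennreal l * indicator (ball 0 R :: (real ^ 'n) set) x \<partial>lebesgue)"
    unfolding sol(2)
  proof (intro nn_integral_mono)
    fix x
    have "\<bar>w x\<bar> ^ CARD('n) \<le> 1" if "x \<in> D"
      using r(1,2)[of x] that closure_subset[of D] by (intro power_le_one) auto
    then show "ennreal (l * \<bar>w x\<bar> ^ CARD('n)) * indicator D x \<le> ennreal l * indicator (ball 0 R) x"
      using assms(2) l by (auto simp: indicator_def intro!: ennreal_leI)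
  qed
  also have "\<dots> = ennreal l * ennreal (measure lebesgue (ball 0 R :: (real^'n) set))"
    by (simp add: nn_integral_cmult_indicator emeasure_eq_measure2 del: emeasure_completion measure_completion)
  also have "\<dots> = ennreal (l * measure lebesgue (ball 0 R :: (real^'n) set))"
    using l by (simp add: ennreal_mult)
  finally show ?thesis using l by (simp add: ennreal_le_iff)
qed

lemma measure_ball_pos: "0 < r \<Longrightarrow> 0 < measure lebesgue (ball a r :: (real ^ 'n) set)"
  using content_ball_pos[of r a] by simp

text \<open>At the minimum point the cone of height \<open>1\<close> has all slopes of norm at most \<open>1 / (2 R)\<close>, so the
  Monge-Ampere mass is bounded below, while it is at most \<open>l\<close> times the volume of the ball of radius \<open>R\<close>.\<close>

lemma eigenvalue_lower_bound:
  assumes "0 < R"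
  obtains c where "0 < c"
    "\<And>(D :: (real ^ 'n) set) l w. normalized_eigenpair D l w \<Longrightarrow> D \<subseteq> ball 0 R \<Longrightarrow> c \<le> l"
proof (rule that)
  let ?B = "\<lambda>r. measure lebesgue (ball 0 r :: (real ^ 'n) set)"
  show "0 < ?B (1 / (2 * R)) / ?B R" using assms measure_ball_pos by simp
  fix D :: "(real ^ 'n) set" and l w
  assume n: "normalized_eigenpair D l w" and DR: "D \<subseteq> ball 0 R"
  note D = normalized_eigenpairD[OF n]
  obtain x0 where x0: "x0 \<in> D" "w x0 = - 1" using eigenfunction_range(3)[OF n] by blast
  have "ball 0 (1 / (2 * R)) \<subseteq> (\<Union>z\<in>D. subdifferential D w z)"
  proof
    fix q :: "real ^ 'n" assume q: "q \<in> ball 0 (1 / (2 * R))"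
    show "q \<in> (\<Union>z\<in>D. subdifferential D w z)"
    proof (rule slopes_in_subdifferential[OF D(1,2,7,8) x0(1)])
      fix y assume "y \<in> D"
      have "norm (y - x0) \<le> norm y + norm x0" by (rule norm_triangle_ineq4)
      also have "\<dots> \<le> R + R"
        using \<open>y \<in> D\<close> x0(1) DR by (intro add_mono) (auto simp: subset_iff less_imp_le)
      also have "R + R = 2 * R" by simp
      finally have "norm q * norm (y - x0) \<le> 1 / (2 * R) * (2 * R)"
        using q assms by (intro mult_mono) auto
      then show "q \<bullet> (y - x0) \<le> - w x0"
        using norm_cauchy_schwarz[of q "y - x0"] assms x0(2) by simp
    qed
  qed
  then have "?B (1 / (2 * R)) \<le> l * ?B R"
    by (intro subdifferential_mass_le[OF n DR]) auto
  then show "?B (1 / (2 * R)) / ?B R \<le> l"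
    using measure_ball_pos[OF assms] by (simp add: pos_divide_le_eq)
qed

lemma eigenfunction_gradient_bound:
  fixes D :: "(real ^ 'n) set"
  assumes "normalized_eigenpair D l w" "p \<in> subdifferential D w x" "cball x d \<subseteq> D" "0 < d"
  shows "norm p \<le> 1 / d"
proof (rule subgradient_norm_bound[OF assms(2-4)])
  fix y assume "y \<in> cball x d"
  then have "y \<in> closure D" "x \<in> closure D" using assms(3,4) closure_subset by fastforce+
  then show "w y - w x \<le> 1"
    using eigenfunction_range(1,2)[OF assms(1)] by (smt (verit))
qed

text \<open>On an interior ball \<open>K\<close> the gradient is bounded, so the Monge-Ampere mass of \<open>K\<close> is bounded above,
  while \<open>|w|\<close> is bounded below there, so this mass is at least a fixed multiple of \<open>l\<close>.\<close>

lemma eigenvalue_upper_bound: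
  fixes a :: "real ^ 'n"
  assumes "0 < R" "0 < \<rho>"
  obtains C where
    "\<And>D l w. normalized_eigenpair D l w \<Longrightarrow> D \<subseteq> ball 0 R \<Longrightarrow> cball a (2 * \<rho>) \<subseteq> D \<Longrightarrow> l \<le> C"
proof (rule that)
  let ?K = "cball a \<rho>" and ?\<kappa> = "\<rho> / (2 * R + \<rho>)" and ?G = "cball 0 (1 / \<rho>) :: (real ^ 'n) set"
  fix D l w
  assume n: "normalized_eigenpair D l w" and DR: "D \<subseteq> ball 0 R" and aD: "cball a (2 * \<rho>) \<subseteq> D"
  note D = normalized_eigenpairD[OF n] and r = eigenfunction_range[OF n]
  have l: "0 < l" by (rule eigenvalue_pos[OF n])
  obtain x0 where x0: "x0 \<in> D" "w x0 = - 1" using r(3) by blast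
  have near: "cball x \<rho> \<subseteq> D" if "x \<in> ?K" for x
  proof -
    have "dist a y \<le> 2 * \<rho>" if "dist x y \<le> \<rho>" for y
      using that \<open>x \<in> ?K\<close> dist_triangle[of a y x] by simp
    then have "cball x \<rho> \<subseteq> cball a (2 * \<rho>)" by auto
    then show ?thesis using aD by blast
  qed
  have KD: "?K \<subseteq> D" using near assms(2) by fastforce
  have decrease: "?\<kappa> \<le> \<bar>w x\<bar>" if "x \<in> ?K" for x
  proof -
    have "norm (x - x0) \<le> norm x + norm x0" by (rule norm_triangle_ineq4)
    also have "\<dots> \<le> R + R"
    proof (rule add_mono)
      have "x \<in> ball 0 R" "x0 \<in> ball 0 R" using that KD x0(1) DR by blast+
      then show "norm x \<le> R" "norm x0 \<le> R" by simp_all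
    qed
    also have "R + R = 2 * R" by simp
    finally have "w x \<le> - ?\<kappa>"
      using r(2) closure_subset x0 near[OF that] assms by (intro convex_interior_decrease[OF D(5)]) auto
    then show ?thesis by simp
  qed
  have KG: "(\<Union>x\<in>?K. subdifferential D w x) \<subseteq> ?G"
    using eigenfunction_gradient_bound[OF n] near assms(2) by auto
  have "ennreal (l * ?\<kappa> ^ CARD('n)) * emeasure lebesgue ?K
      = (\<integral>\<^sup>+x. ennreal (l * ?\<kappa> ^ CARD('n)) * indicator ?K x \<partial>lebesgue)"
    by (simp add: nn_integral_cmult_indicator del: emeasure_completion)
  also have "\<dots> \<le> (\<integral>\<^sup>+x\<in>?K. ennreal (l * \<bar>w x\<bar> ^ CARD('n)) \<partial>lebesgue)"
    using decrease l assms
    by (intro nn_integral_mono) (auto simp: indicator_def intro!: ennreal_leI mult_left_mono power_mono)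
  also have "\<dots> = emeasure lebesgue (\<Union>x\<in>?K. subdifferential D w x)"
    using eigenfunction_aleksandrov_solution[OF n, unfolded aleksandrov_solution_def, rule_format, of ?K] KD
    by simp
  also have "\<dots> \<le> emeasure lebesgue ?G" using KG by (intro emeasure_mono) auto
  finally have "ennreal (l * ?\<kappa> ^ CARD('n) * measure lebesgue ?K) \<le> ennreal (measure lebesgue ?G)"
    using l assms by (simp add: emeasure_eq_measure2 ennreal_mult del: emeasure_completion measure_completion)
  then have "l * (?\<kappa> ^ CARD('n) * measure lebesgue ?K) \<le> measure lebesgue ?G"
    by (simp add: ennreal_le_iff mult.assoc del: measure_completion)
  moreover have "0 < ?\<kappa> ^ CARD('n) * measure lebesgue ?K"
    using assms content_cball_pos[of \<rho> a] by simp
  ultimately show "l \<le> measure lebesgue ?G / (?\<kappa> ^ CARD('n) * measure lebesgue ?K)"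
    by (subst pos_le_divide_eq)
qed

lemma supporting_unit_normal:
  fixes z :: "'a::euclidean_space"
  assumes "convex S" "z \<notin> S"
  obtains n where "norm n = 1" "\<And>y. y \<in> S \<Longrightarrow> n \<bullet> (y - z) \<le> 0"
proof -
  have "convex ((\<lambda>y. z - y) ` S)"
    using assms(1) convex_translation[of "uminus ` S" z] convex_negations[OF assms(1)]
    by (simp add: image_image)
  moreover have "0 \<notin> (\<lambda>y. z - y) ` S" using assms(2) by auto
  ultimately obtain a where a: "a \<noteq> 0" "\<forall>x\<in>(\<lambda>y. z - y) ` S. 0 \<le> a \<bullet> x"
    using separating_hyperplane_set_0 by blast
  show ?thesis
  proof (rule that[of "a /\<^sub>R norm a"])
    show "norm (a /\<^sub>R norm a) = 1" using a(1) by simp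
    fix y assume "y \<in> S"
    then have "a \<bullet> (y - z) \<le> 0" using a(2) by (simp add: inner_diff_right)
    then show "(a /\<^sub>R norm a) \<bullet> (y - z) \<le> 0" by (simp add: mult_nonneg_nonpos)
  qed
qed

text \<open>A qualitative form of the Aleksandrov maximum principle. If \<open>t = -w x \<ge> \<epsilon>\<close> and the boundary is closer
  than \<open>\<delta>\<close> to \<open>x\<close>, then the slopes of the cone over \<open>x\<close> form a convex set that contains the ball of
  radius \<open>t / (2 R)\<close> and, in the direction of the outer normal, the point \<open>p\<close> of norm \<open>t / \<delta>\<close>. It
  therefore contains many disjoint balls of radius \<open>t / (4 R)\<close> centred on the segment from \<open>0\<close> to
  \<open>p / 2\<close>. Their number grows like \<open>R / \<delta>\<close>, but the total mass is bounded by \<open>C\<close> times the volume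
  of the ball of radius \<open>R\<close>; so \<open>\<delta>\<close> cannot be small.\<close>

lemma boundary_decay:
  assumes "0 < R" "0 < \<epsilon>"
  obtains \<delta> where "0 < \<delta>"
    "\<And>(D :: (real ^ 'n) set) l w x. normalized_eigenpair D l w \<Longrightarrow> D \<subseteq> ball 0 R \<Longrightarrow> l \<le> C \<Longrightarrow>
       x \<in> D \<Longrightarrow> \<not> ball x \<delta> \<subseteq> D \<Longrightarrow> - \<epsilon> < w x"
proof -
  let ?B = "\<lambda>r. measure lebesgue (ball 0 r :: (real ^ 'n) set)"
  obtain N :: nat where N: "C * ?B R < real N * ?B (\<epsilon> / (4 * R))"
    using ex_less_of_nat_mult[OF measure_ball_pos] assms by (metis divide_pos_pos mult_pos_pos zero_less_numeral)
  \<comment> \<open>the number of balls, positive so that \<open>\<delta> = R / N'\<close> makes sense; together they exceed the available mass\<close>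
  define N' where "N' = Suc N"
  have N': "0 < N'" "C * ?B R < real N' * ?B (\<epsilon> / (4 * R))"
  proof -
    have "real N * ?B (\<epsilon> / (4 * R)) \<le> real N' * ?B (\<epsilon> / (4 * R))"
      by (intro mult_right_mono) (auto simp: N'_def)
    with N show "0 < N'" "C * ?B R < real N' * ?B (\<epsilon> / (4 * R))" by (auto simp: N'_def)
  qed
  let ?\<delta> = "R / real N'"
  have "- \<epsilon> < w x" if n: "normalized_eigenpair D l w" and DR: "D \<subseteq> ball 0 R" and lC: "l \<le> C"
    and x: "x \<in> D" and nb: "\<not> ball x ?\<delta> \<subseteq> D" for D :: "(real ^ 'n) set" and l w x
  proof (rule ccontr)
    note D = normalized_eigenpairD[OF n]
    assume "\<not> - \<epsilon> < w x"
    define t where "t = - w x"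
    have t: "\<epsilon> \<le> t" "0 < t" using \<open>\<not> - \<epsilon> < w x\<close> assms(2) by (auto simp: t_def)
    obtain z where "z \<in> ball x ?\<delta>" and "z \<notin> D" using nb by blast
    then have z: "z \<notin> D" "norm (z - x) < ?\<delta>" by (simp_all add: dist_norm norm_minus_commute)
    obtain \<nu> where \<nu>: "norm \<nu> = 1" "\<And>y. y \<in> D \<Longrightarrow> \<nu> \<bullet> (y - z) \<le> 0"
      using supporting_unit_normal[OF D(3) z(1)] by blast
    have \<delta>: "0 < ?\<delta>" using assms(1) N'(1) by simp
    define p where "p = (t / ?\<delta>) *\<^sub>R \<nu>"
    have p: "p \<bullet> (y - x) \<le> t" if "y \<in> D" for y
    proof -
      have "\<nu> \<bullet> (y - x) = \<nu> \<bullet> (y - z) + \<nu> \<bullet> (z - x)" by (simp add: inner_diff_right)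
      also have "\<dots> \<le> 0 + norm \<nu> * norm (z - x)"
        using \<nu>(2)[OF that] norm_cauchy_schwarz by (intro add_mono)
      also have "\<dots> \<le> ?\<delta>" using \<nu>(1) z(2) by simp
      finally have "(t / ?\<delta>) * (\<nu> \<bullet> (y - x)) \<le> (t / ?\<delta>) * ?\<delta>"
        using t \<delta> by (intro mult_left_mono divide_nonneg_pos) simp_all
      also have "\<dots> = t" using assms(1) N'(1) by simp
      finally show ?thesis by (simp only: p_def inner_scaleR_left)
    qed
    \<comment> \<open>consecutive centres on the segment from \<open>0\<close> to \<open>p / 2\<close> are \<open>t / (2 R)\<close> apart, which is twice the radius\<close>
    define A where "A k = ball ((real k / (2 * real N')) *\<^sub>R p) (t / (4 * R))" for k
    have A_sub: "A k \<subseteq> (\<Union>z\<in>D. subdifferential D w z)" if "k < N'" for k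
    proof
      fix q assume q: "q \<in> A k"
      define s where "s = real k / (2 * real N')"
      have s: "0 \<le> s" "s \<le> 1 / 2" using that by (auto simp: s_def field_simps)
      define b where "b = q - s *\<^sub>R p"
      have b: "norm b \<le> t / (4 * R)"
        using q by (simp add: A_def b_def s_def dist_norm norm_minus_commute)
      show "q \<in> (\<Union>z\<in>D. subdifferential D w z)"
      proof (rule slopes_in_subdifferential[OF D(1,2,7,8) x])
        fix y assume "y \<in> D"
        have "norm (y - x) \<le> norm y + norm x" by (rule norm_triangle_ineq4)
        also have "\<dots> \<le> R + R"
          using \<open>y \<in> D\<close> x DR by (intro add_mono) (auto simp: subset_iff less_imp_le)
        also have "R + R = 2 * R" by simp
        finally have "norm b * norm (y - x) \<le> t / (4 * R) * (2 * R)"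
          using b t(2) assms(1) by (intro mult_mono) auto
        then have "b \<bullet> (y - x) \<le> t / 2"
          using norm_cauchy_schwarz[of b "y - x"] assms(1) by simp
        moreover have "s * (p \<bullet> (y - x)) \<le> 1 / 2 * t"
        proof -
          have "s * (p \<bullet> (y - x)) \<le> s * t" using p[OF \<open>y \<in> D\<close>] s by (intro mult_left_mono)
          also have "\<dots> \<le> 1 / 2 * t" using s t(2) by (intro mult_right_mono) auto
          finally show ?thesis .
        qed
        moreover have "q \<bullet> (y - x) = s * (p \<bullet> (y - x)) + b \<bullet> (y - x)"
          by (simp add: b_def inner_diff_left)
        ultimately show "q \<bullet> (y - x) \<le> - w x" by (simp add: t_def)
      qed
    qed
    have A_disj: "A j \<inter> A k = {}" if "j < k" for j k
    proof -
      have np: "norm p = t / ?\<delta>" using \<nu>(1) t(2) assms(1) by (simp add: p_def)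
      have "dist ((real j / (2 * real N')) *\<^sub>R p) ((real k / (2 * real N')) *\<^sub>R p)
          = norm ((real j / (2 * real N') - real k / (2 * real N')) *\<^sub>R p)"
        by (simp add: dist_norm scaleR_left_diff_distrib)
      also have "\<dots> = \<bar>real j / (2 * real N') - real k / (2 * real N')\<bar> * (t / ?\<delta>)"
        by (simp add: np)
      also have "\<bar>real j / (2 * real N') - real k / (2 * real N')\<bar> = (real k - real j) / (2 * real N')"
        using that N'(1) by (simp add: abs_if diff_divide_distrib divide_strict_right_mono)
      also have "(real k - real j) / (2 * real N') * (t / ?\<delta>) = (real k - real j) * (t / (2 * R))"
        using N'(1) assms(1) by (simp add: field_simps)
      also have "\<dots> \<ge> 1 * (t / (2 * R))" using that t assms(1) by (intro mult_right_mono) auto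
      finally show ?thesis
        unfolding A_def by (intro disjoint_ballI) (simp add: field_simps)
    qed
    then have disj: "disjoint_family_on A {..<N'}"
      unfolding disjoint_family_on_def by (metis inf_commute linorder_neqE_nat)
    have "real N' * ?B (\<epsilon> / (4 * R)) \<le> real N' * ?B (t / (4 * R))"
      using t assms by (intro mult_left_mono measure_mono_fmeasurable subset_ball divide_right_mono) auto
    also have "\<dots> = (\<Sum>k<N'. measure lebesgue (A k))"
    proof -
      have "measure lebesgue (A k) = ?B (t / (4 * R))" for k
        using t assms unfolding A_def by (simp add: content_ball)
      then show ?thesis by simp
    qed
    also have "\<dots> = measure lebesgue (\<Union>k<N'. A k)"
      using fmeasurableD2[OF lmeasurable_ball]
      by (intro measure_finite_Union[symmetric] disj) (auto simp: A_def)
    also have "\<dots> \<le> l * ?B R"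
      using A_sub by (intro subdifferential_mass_le[OF n DR]) (auto simp: A_def intro!: fmeasurable.finite_UN)
    also have "\<dots> \<le> C * ?B R" using lC by (intro mult_right_mono) auto
    finally show False using N'(2) by simp
  qed
  moreover have "0 < ?\<delta>" using assms(1) N'(1) by simp
  ultimately show ?thesis using that by blast
qed


section \<open>Compactness and passage to the limit\<close>

lemma eigenfunction_interior_lipschitz:
  fixes D :: "(real ^ 'n) set"
  assumes "normalized_eigenpair D l w" "cball x d \<subseteq> D" "cball y d \<subseteq> D" "0 < d"
  shows "\<bar>w x - w y\<bar> \<le> norm (x - y) / d"
proof -
  note D = normalized_eigenpairD[OF assms(1)]
  have "w z - w z' \<le> norm (z - z') / d" if z: "cball z d \<subseteq> D" and z': "z' \<in> D" for z z'
  proof -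
    have "z \<in> D" using z assms(4) by auto
    then have p: "grad w z \<in> subdifferential D w z"
      using subdifferential_smooth[OF D(1,5,6)] by blast
    then have "w z - w z' \<le> grad w z \<bullet> (z - z')"
      using z' by (force simp: subdifferential_def inner_diff_right)
    also have "\<dots> \<le> norm (grad w z) * norm (z - z')" by (rule norm_cauchy_schwarz)
    also have "\<dots> \<le> 1 / d * norm (z - z')"
      using eigenfunction_gradient_bound[OF assms(1) p z assms(4)] by (intro mult_right_mono) auto
    finally show ?thesis by simp
  qed
  from this[of x y] this[of y x] show ?thesis
    using assms(2-4) by (auto simp: abs_le_iff norm_minus_commute subset_iff)
qed

text \<open>Extending by zero gives all eigenfunctions a common domain, so that one application of the
  Arzela-Ascoli theorem yields convergence up to the boundary.\<close>

definition zero_extension :: "'a set \<Rightarrow> ('a \<Rightarrow> real) \<Rightarrow> 'a \<Rightarrow> real" where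
  "zero_extension D w x = (if x \<in> D then w x else 0)"

lemma zero_extension_bounds:
  assumes "normalized_eigenpair D l w"
  shows "- 1 \<le> zero_extension D w x" "zero_extension D w x \<le> 0"
  using eigenfunction_range(1,2)[OF assms, of x] closure_subset[of D]
  by (auto simp: zero_extension_def)

text \<open>Two points that both have distance at least \<open>\<delta> / 2\<close> to the complement are covered by the interior
  gradient bound; otherwise both values are small by decay at the boundary.\<close>

lemma zero_extension_equicontinuous:
  assumes "0 < R" "0 < \<epsilon>"
  obtains \<eta> where "0 < \<eta>"
    "\<And>(D :: (real ^ 'n) set) l w x y. normalized_eigenpair D l w \<Longrightarrow> D \<subseteq> ball 0 R \<Longrightarrow> l \<le> C \<Longrightarrow>
       norm (x - y) < \<eta> \<Longrightarrow> \<bar>zero_extension D w x - zero_extension D w y\<bar> < \<epsilon>"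
proof -
  obtain \<delta> where \<delta>: "0 < \<delta>"
    "\<And>(D :: (real ^ 'n) set) l w x. normalized_eigenpair D l w \<Longrightarrow> D \<subseteq> ball 0 R \<Longrightarrow> l \<le> C \<Longrightarrow>
       x \<in> D \<Longrightarrow> \<not> ball x \<delta> \<subseteq> D \<Longrightarrow> - \<epsilon> < w x"
    using boundary_decay[OF assms, of C] by blast
  define \<eta> where "\<eta> = min (\<delta> / 2) (\<epsilon> * \<delta> / 2)"
  show ?thesis
  proof (rule that[of \<eta>])
    show "0 < \<eta>" using \<delta>(1) assms(2) by (simp add: \<eta>_def)
    fix D :: "(real ^ 'n) set" and l w and x y :: "real ^ 'n"
    assume n: "normalized_eigenpair D l w" and DR: "D \<subseteq> ball 0 R" and lC: "l \<le> C"
      and xy: "norm (x - y) < \<eta>"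
    have small: "- \<epsilon> < zero_extension D w z" if "\<not> ball z \<delta> \<subseteq> D" for z
      using \<delta>(2)[OF n DR lC _ that] assms(2) by (simp add: zero_extension_def)
    show "\<bar>zero_extension D w x - zero_extension D w y\<bar> < \<epsilon>"
    proof (cases "cball x (\<delta> / 2) \<subseteq> D \<and> cball y (\<delta> / 2) \<subseteq> D")
      case True
      then have "x \<in> D" "y \<in> D" using \<delta>(1) by auto
      then have "\<bar>zero_extension D w x - zero_extension D w y\<bar> \<le> norm (x - y) / (\<delta> / 2)"
        using eigenfunction_interior_lipschitz[OF n, of x "\<delta> / 2" y] True \<delta>(1)
        by (simp add: zero_extension_def)
      also have "\<dots> < \<epsilon>" using xy \<delta>(1) by (simp add: \<eta>_def field_simps)
      finally show ?thesis .
    next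
      case False
      then obtain z where z: "z \<notin> D" "norm (x - z) \<le> \<delta> / 2 \<or> norm (y - z) \<le> \<delta> / 2"
        unfolding subset_iff mem_cball dist_norm by blast
      have "norm (x - z) \<le> norm (x - y) + norm (y - z)" "norm (y - z) \<le> norm (x - y) + norm (x - z)"
        using norm_triangle_ineq[of "x - y" "y - z"] norm_triangle_ineq[of "y - x" "x - z"]
        by (simp_all add: norm_minus_commute)
      moreover have "norm (x - y) < \<delta> / 2" using xy by (simp add: \<eta>_def)
      ultimately have "norm (x - z) < \<delta>" "norm (y - z) < \<delta>" using z(2) \<delta>(1) by auto
      then have "\<not> ball x \<delta> \<subseteq> D" "\<not> ball y \<delta> \<subseteq> D" using z(1) by (auto simp: dist_norm)
      then show ?thesis
        using small zero_extension_bounds(2)[OF n] by (smt (verit))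
    qed
  qed
qed

lemma infdist_le_hausdorff_distance:
  assumes "bounded A" "B \<noteq> {}" "a \<in> A"
  shows "infdist a B \<le> hausdorff_distance A B"
proof -
  obtain b where b: "b \<in> B" using assms(2) by blast
  obtain M where M: "\<And>x. x \<in> A \<Longrightarrow> dist b x \<le> M"
    using assms(1) by (auto simp: bounded_any_center[of A b])
  have "bdd_above ((\<lambda>a. infdist a B) ` A)"
  proof (rule bdd_aboveI2)
    show "infdist x B \<le> M" if "x \<in> A" for x
      using infdist_le[OF b, of x] M[OF that] by (simp add: dist_commute)
  qed
  then have "infdist a B \<le> (SUP a\<in>A. infdist a B)" by (intro cSUP_upper assms(3))
  then show ?thesis by (simp add: hausdorff_distance_def)
qed

lemma hausdorff_distance_commute: "hausdorff_distance A B = hausdorff_distance B A"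
  by (simp add: hausdorff_distance_def max.commute)

lemma hausdorff_distance_nearby:
  assumes "bounded A" "B \<noteq> {}" "hausdorff_distance A B < h" "a \<in> A"
  obtains b where "b \<in> B" "dist a b < h"
proof -
  have "infdist a B < h" using infdist_le_hausdorff_distance[OF assms(1,2,4)] assms(3) by simp
  then have "(INF b\<in>B. dist a b) < h" using assms(2) by (simp add: infdist_def)
  then show ?thesis using that assms(2) by (auto simp: cINF_less_iff)
qed

text \<open>If a point \<open>y\<close> of the smaller ball were not in \<open>B\<close>, moving from \<open>y\<close> by \<open>h\<close> along an outer normal of \<open>B\<close>
  would give a point of \<open>A\<close> at distance at least \<open>h\<close> from \<open>B\<close>. Applied in both directions, this compares the
  interiors of the approximating domains with that of the limit domain.\<close>

lemma hausdorff_distance_ball_subset: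
  fixes A B :: "'a::euclidean_space set"
  assumes "bounded A" "B \<noteq> {}" "convex B" "hausdorff_distance A B < h" "0 \<le> h" "ball x d \<subseteq> A"
  shows "ball x (d - h) \<subseteq> B"
proof (rule subsetI, rule ccontr)
  fix y assume y: "y \<in> ball x (d - h)" "y \<notin> B"
  obtain n where n: "norm n = 1" "\<And>b. b \<in> B \<Longrightarrow> n \<bullet> (b - y) \<le> 0"
    using supporting_unit_normal[OF assms(3) y(2)] by blast
  define z where "z = y + h *\<^sub>R n"
  have "norm (z - x) \<le> norm (y - x) + norm (h *\<^sub>R n)"
    using norm_triangle_ineq[of "y - x" "h *\<^sub>R n"] by (simp add: z_def algebra_simps)
  also have "\<dots> < d" using y(1) n(1) assms(5) by (simp add: dist_norm norm_minus_commute)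
  finally have "z \<in> A" using assms(6) by (auto simp: dist_norm norm_minus_commute)
  then obtain b where b: "b \<in> B" "dist z b < h"
    using hausdorff_distance_nearby[OF assms(1,2,4)] by blast
  have "h = n \<bullet> (z - y)" using n(1) by (simp add: z_def norm_eq_1)
  also have "\<dots> = n \<bullet> (z - b) + n \<bullet> (b - y)" by (simp add: inner_diff_right)
  also have "\<dots> \<le> norm n * norm (z - b) + 0"
    using n(2)[OF b(1)] norm_cauchy_schwarz by (intro add_mono)
  also have "\<dots> < h" using n(1) b(2) by (simp add: dist_norm)
  finally show False by simp
qed

lemma uniform_limit_abs_power:
  fixes v :: "'i \<Rightarrow> 'a \<Rightarrow> real"
  assumes "uniform_limit S v u F" "\<And>x. x \<in> S \<Longrightarrow> \<bar>u x\<bar> \<le> M"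
  shows "uniform_limit S (\<lambda>i x. \<bar>v i x\<bar> ^ k) (\<lambda>x. \<bar>u x\<bar> ^ k) F"
proof (induction k)
  case (Suc k)
  have abs: "uniform_limit S (\<lambda>i x. \<bar>v i x\<bar>) (\<lambda>x. \<bar>u x\<bar>) F"
    unfolding uniform_limit_iff
  proof (intro allI impI)
    fix e :: real assume "e > 0"
    from uniform_limitD[OF assms(1) this]
    show "\<forall>\<^sub>F i in F. \<forall>x\<in>S. dist \<bar>v i x\<bar> \<bar>u x\<bar> < e"
      by eventually_elim (force simp: dist_real_def)
  qed
  have "bounded ((\<lambda>x. \<bar>u x\<bar>) ` S)"
    using assms(2) by (auto simp: bounded_iff)
  moreover have "bounded ((\<lambda>x. \<bar>u x\<bar> ^ k) ` S)"
    unfolding bounded_iff using assms(2)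
    by (intro exI[of _ "M ^ k"]) (auto intro!: power_mono simp: power_abs)
  ultimately show ?case
    using uniform_lim_mult[OF abs Suc.IH] by simp
qed (simp add: uniform_limit_iff)

text \<open>After finitely many indices all domains lie in one ball and contain another, so the estimates above
  hold with common constants.\<close>

theorem proposition5p2:
  fixes \<Omega> :: "(real ^ 'n) set"
    and \<Omega>m :: "nat \<Rightarrow> (real ^ 'n) set"
    and um :: "nat \<Rightarrow> real ^ 'n \<Rightarrow> real"
  assumes "CARD('n) \<ge> 2"
    and "convex_domain \<Omega>"
    and "\<And>m. convex_domain (\<Omega>m m)"
    and "\<And>m. smooth_boundary (\<Omega>m m)"
    and "\<And>m. uniformly_convex (\<Omega>m m)"
    and "(\<lambda>m. hausdorff_distance (\<Omega>m m) \<Omega>) \<longlonglongrightarrow> 0"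
    and "\<And>m. MA_eigenfunction (\<Omega>m m) (MA_eigenvalue (\<Omega>m m)) (um m)"
    and "\<And>m. Linfty_norm (\<Omega>m m) (um m) = 1"
  shows "\<exists>(r :: nat \<Rightarrow> nat) (\<Lambda> :: real) (u :: real ^ 'n \<Rightarrow> real).
           strict_mono r \<and> \<Lambda> > 0 \<and>
           (\<lambda>m. MA_eigenvalue (\<Omega>m (r m))) \<longlonglongrightarrow> \<Lambda> \<and>
           (\<forall>K. compact K \<and> K \<subseteq> \<Omega> \<longrightarrow> uniform_limit K (\<lambda>m. um (r m)) u sequentially) \<and>
           convex_on \<Omega> u \<and> (\<exists>x\<in>\<Omega>. u x \<noteq> 0) \<and>
           aleksandrov_solution \<Omega> u (\<lambda>x. \<Lambda> * \<bar>u x\<bar> ^ CARD('n)) \<and>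
           continuous_on (closure \<Omega>) u \<and> (\<forall>x\<in>frontier \<Omega>. u x = 0)"
proof -
  define \<mu> where "\<mu> m = MA_eigenvalue (\<Omega>m m)" for m
  have \<Omega>: "open \<Omega>" "bounded \<Omega>" "convex \<Omega>" "\<Omega> \<noteq> {}"
    using assms(2) by (auto simp: convex_domain_def)
  have eig: "normalized_eigenpair (\<Omega>m m) (\<mu> m) (um m)" for m
    using assms(3,7,8) by (simp add: normalized_eigenpair_def \<mu>_def)
  note Dm = normalized_eigenpairD[OF eig]
  have hd: "\<forall>\<^sub>F m in sequentially. hausdorff_distance (\<Omega>m m) \<Omega> < h" if "0 < h" for h
    using order_tendstoD(2)[OF assms(6) that] .
  have inner_ball: "ball x (d - h) \<subseteq> \<Omega>m m"
    if "hausdorff_distance (\<Omega>m m) \<Omega> < h" "0 \<le> h" "ball x d \<subseteq> \<Omega>" for m h d x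
    using hausdorff_distance_ball_subset[OF \<Omega>(2) Dm(4,3)] that
    by (simp add: hausdorff_distance_commute[of \<Omega>])
  have outer_ball: "ball x (d - h) \<subseteq> \<Omega>"
    if "hausdorff_distance (\<Omega>m m) \<Omega> < h" "0 \<le> h" "ball x d \<subseteq> \<Omega>m m" for m h d x
    using hausdorff_distance_ball_subset[OF Dm(2) \<Omega>(4,3)] that by simp

  obtain a d where d: "0 < d" "ball a d \<subseteq> \<Omega>"
    using \<Omega>(1,4) open_contains_ball by (metis ex_in_conv)
  obtain R0 where R0: "0 < R0" "\<And>x. x \<in> \<Omega> \<Longrightarrow> norm x < R0"
    using \<Omega>(2) by (metis bounded_pos_less)
  define R where "R = R0 + 1"
  have R: "0 < R" "closure \<Omega> \<subseteq> cball 0 R"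
  proof -
    show "0 < R" using R0(1) by (simp add: R_def)
    have "\<Omega> \<subseteq> cball 0 R" using R0(2) by (force simp: R_def)
    then show "closure \<Omega> \<subseteq> cball 0 R" by (intro closure_minimal) auto
  qed
  have "\<forall>\<^sub>F m in sequentially. \<Omega>m m \<subseteq> ball 0 R \<and> cball a (2 * (d / 8)) \<subseteq> \<Omega>m m"
    using hd[OF zero_less_one] hd[OF half_gt_zero[OF d(1)]]
  proof eventually_elim
    case (elim m)
    have "norm x < R" if "x \<in> \<Omega>m m" for x
    proof -
      obtain y where "y \<in> \<Omega>" "dist x y < 1"
        using hausdorff_distance_nearby[OF Dm(2) \<Omega>(4) elim(1) \<open>x \<in> \<Omega>m m\<close>] by blast
      then show ?thesis
        using R0(2)[of y] norm_triangle_ineq2[of x y] by (simp add: R_def dist_norm)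
    qed
    moreover have "ball a (d - d / 2) \<subseteq> \<Omega>m m" using inner_ball[OF elim(2) _ d(2)] d(1) by simp
    moreover have "cball a (2 * (d / 8)) \<subseteq> ball a (d - d / 2)" using d(1) by auto
    ultimately show ?case by (auto simp: subset_iff)
  qed
  then obtain N0 where N0: "\<And>m. N0 \<le> m \<Longrightarrow> \<Omega>m m \<subseteq> ball 0 R"
      "\<And>m. N0 \<le> m \<Longrightarrow> cball a (2 * (d / 8)) \<subseteq> \<Omega>m m"
    unfolding eventually_sequentially by blast
  obtain c where c: "0 < c" "\<And>m. N0 \<le> m \<Longrightarrow> c \<le> \<mu> m"
    using eigenvalue_lower_bound[OF R(1)] eig N0(1) by metis
  have "0 < d / 8" using d(1) by simp
  obtain C where C: "\<And>m. N0 \<le> m \<Longrightarrow> \<mu> m \<le> C"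
    using eigenvalue_upper_bound[OF R(1) \<open>0 < d / 8\<close>, of a] eig N0 by metis

  have "\<mu> (N0 + m) \<in> {c..C}" for m using c(2) C by simp
  then obtain \<Lambda> r1 where \<Lambda>: "\<Lambda> \<in> {c..C}" "strict_mono (r1 :: nat \<Rightarrow> nat)"
      "((\<lambda>m. \<mu> (N0 + m)) \<circ> r1) \<longlonglongrightarrow> \<Lambda>"
    using compact_Icc[of c C] unfolding compact_def by metis
  \<comment> \<open>the tail from \<open>N0\<close> on, along a subsequence for which the eigenvalues converge\<close>
  define F where "F n = zero_extension (\<Omega>m (N0 + r1 n)) (um (N0 + r1 n))" for n
  have F_bounds: "- 1 \<le> F n x" "F n x \<le> 0" for n x
    using zero_extension_bounds[OF eig] by (auto simp: F_def)
  obtain g k where g: "continuous_on (cball 0 R) g" "strict_mono (k :: nat \<Rightarrow> nat)"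
      "\<And>e. 0 < e \<Longrightarrow> \<exists>N. \<forall>n x. n \<ge> N \<and> x \<in> cball 0 R \<longrightarrow> norm (F (k n) x - g x) < e"
  proof (rule Arzela_Ascoli[of "cball 0 R" F 1])
    show "compact (cball (0 :: real ^ 'n) R)" by simp
    show "norm (F n x) \<le> 1" for n x using F_bounds[of n x] by simp
    fix x and e :: real assume "0 < e"
    obtain \<eta> where \<eta>: "0 < \<eta>"
      "\<And>(D :: (real ^ 'n) set) l w x y. normalized_eigenpair D l w \<Longrightarrow> D \<subseteq> ball 0 R \<Longrightarrow> l \<le> C \<Longrightarrow>
         norm (x - y) < \<eta> \<Longrightarrow> \<bar>zero_extension D w x - zero_extension D w y\<bar> < e"
      using zero_extension_equicontinuous[OF R(1) \<open>0 < e\<close>, of C] by blast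
    have "norm (F n x - F n y) < e" if "norm (x - y) < \<eta>" for n y
      using \<eta>(2)[OF eig N0(1) C that] by (simp add: F_def)
    then show "\<exists>d>0. \<forall>n y. y \<in> cball 0 R \<and> norm (x - y) < d \<longrightarrow> norm (F n x - F n y) < e"
      using \<eta>(1) by blast
  qed (use that in blast)

  define r where "r j = N0 + r1 (k j)" for j
  have mono_r: "strict_mono r"
    using \<Lambda>(2) g(2) by (auto simp: r_def strict_mono_def)
  have r_ge: "N0 \<le> r j" for j by (simp add: r_def)
  have F_eq: "F (k j) = zero_extension (\<Omega>m (r j)) (um (r j))" for j by (simp add: F_def r_def)
  have lim_\<mu>: "(\<lambda>j. \<mu> (r j)) \<longlonglongrightarrow> \<Lambda>"
    using LIMSEQ_subseq_LIMSEQ[OF \<Lambda>(3) g(2)] by (simp add: r_def o_def)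
  have hdr: "\<forall>\<^sub>F j in sequentially. hausdorff_distance (\<Omega>m (r j)) \<Omega> < h" if "0 < h" for h
    using eventually_subseq[OF mono_r hd[OF that]] .
  have lim_F: "uniform_limit (cball 0 R) (\<lambda>j. F (k j)) g sequentially"
    unfolding uniform_limit_iff eventually_sequentially
    using g(3) by (fastforce simp: dist_norm)
  have lim_F_pt: "(\<lambda>j. F (k j) x) \<longlonglongrightarrow> g x" if "x \<in> cball 0 R" for x
    by (rule tendsto_uniform_limitI[OF lim_F that])
  have in_S: "\<Omega> \<subseteq> cball 0 R" using R(2) closure_subset by blast

  have subset_K: "\<forall>\<^sub>F j in sequentially. K \<subseteq> \<Omega>m (r j)" if "compact K" "K \<subseteq> \<Omega>" for K
  proof -
    obtain e E where e: "e > 0" "E \<subseteq> \<Omega>" "\<And>x. x \<in> K \<Longrightarrow> cball x e \<subseteq> E"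
      using compact_enlargement[OF \<open>compact K\<close> \<Omega>(1) \<open>K \<subseteq> \<Omega>\<close>] by metis
    from hdr[OF half_gt_zero[OF e(1)]] show ?thesis
    proof eventually_elim
      case (elim j)
      show ?case
      proof
        fix x assume "x \<in> K"
        then have "ball x e \<subseteq> \<Omega>" using e(2,3) ball_subset_cball by blast
        from inner_ball[OF elim _ this] have "ball x (e - e / 2) \<subseteq> \<Omega>m (r j)" using e(1) by simp
        moreover have "x \<in> ball x (e - e / 2)" using e(1) by simp
        ultimately show "x \<in> \<Omega>m (r j)" by blast
      qed
    qed
  qed
  have lim_u: "uniform_limit K (\<lambda>j. um (r j)) g sequentially" if "compact K" "K \<subseteq> \<Omega>" for K
  proof -
    have "K \<subseteq> cball 0 R" using that(2) in_S by blast
    then have "uniform_limit K (\<lambda>j. F (k j)) g sequentially"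
      by (rule uniform_limit_on_subset[OF lim_F])
    moreover have "\<forall>\<^sub>F j in sequentially. \<forall>x\<in>K. F (k j) x = um (r j) x"
      using subset_K[OF that] by eventually_elim (auto simp: F_eq zero_extension_def)
    ultimately show ?thesis
      by (rule uniform_limit_cong[THEN iffD1, rotated -1]) auto
  qed
  have lim_pt: "(\<lambda>j. um (r j) x) \<longlonglongrightarrow> g x" if "x \<in> \<Omega>" for x
    using lim_u[of "{x}"] that by (auto intro: tendsto_uniform_limitI)

  have zero: "g x = 0" if "x \<in> frontier \<Omega>" for x
  proof -
    have x: "x \<in> cball 0 R" "x \<notin> \<Omega>"
      using that R(2) \<Omega>(1) by (auto simp: frontier_def interior_open)
    have "\<bar>g x\<bar> \<le> \<epsilon>" if "0 < \<epsilon>" for \<epsilon>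
    proof -
      obtain \<delta> where \<delta>: "0 < \<delta>"
        "\<And>(D :: (real ^ 'n) set) l w x. normalized_eigenpair D l w \<Longrightarrow> D \<subseteq> ball 0 R \<Longrightarrow> l \<le> C \<Longrightarrow>
           x \<in> D \<Longrightarrow> \<not> ball x \<delta> \<subseteq> D \<Longrightarrow> - \<epsilon> < w x"
        using boundary_decay[OF R(1) \<open>0 < \<epsilon>\<close>, of C] by blast
      \<comment> \<open>a large ball about a point outside \<open>\<Omega>\<close> cannot lie in late domains, so decay at the boundary applies at \<open>x\<close>\<close>
      have "\<forall>\<^sub>F j in sequentially. \<bar>F (k j) x\<bar> \<le> \<epsilon>"
        using hdr[OF half_gt_zero[OF \<delta>(1)]]
      proof eventually_elim
        case (elim j)
        have "\<not> ball x \<delta> \<subseteq> \<Omega>m (r j)"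
        proof
          assume "ball x \<delta> \<subseteq> \<Omega>m (r j)"
          from outer_ball[OF elim _ this] have "ball x (\<delta> - \<delta> / 2) \<subseteq> \<Omega>" using \<delta>(1) by simp
          moreover have "x \<in> ball x (\<delta> - \<delta> / 2)" using \<delta>(1) by simp
          ultimately show False using x(2) by blast
        qed
        then have "- \<epsilon> < F (k j) x"
          using \<delta>(2)[OF eig N0(1)[OF r_ge] C[OF r_ge]] that
          by (auto simp: F_eq zero_extension_def)
        then show ?case using F_bounds(2)[of "k j" x] by simp
      qed
      then show ?thesis
        using tendsto_upperbound[OF tendsto_rabs[OF lim_F_pt[OF x(1)]]] by simp
    qed
    then show ?thesis by (metis abs_le_zero_iff dense_ge)
  qed

  have nonzero: "\<exists>x\<in>\<Omega>. g x \<noteq> 0"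
  proof -
    obtain \<delta> where \<delta>: "0 < \<delta>"
      "\<And>(D :: (real ^ 'n) set) l w x. normalized_eigenpair D l w \<Longrightarrow> D \<subseteq> ball 0 R \<Longrightarrow> l \<le> C \<Longrightarrow>
         x \<in> D \<Longrightarrow> \<not> ball x \<delta> \<subseteq> D \<Longrightarrow> - 1 < w x"
      using boundary_decay[OF R(1) zero_less_one, of C] by blast
    have "\<forall>\<^sub>F j in sequentially. hausdorff_distance (\<Omega>m (r j)) \<Omega> < \<delta> / 2 \<and>
        (\<forall>x\<in>cball 0 R. dist (F (k j) x) (g x) < 1)"
      using hdr[OF half_gt_zero[OF \<delta>(1)]] uniform_limitD[OF lim_F zero_less_one]
      by eventually_elim blast
    then obtain j where j: "hausdorff_distance (\<Omega>m (r j)) \<Omega> < \<delta> / 2"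
        "\<And>x. x \<in> cball 0 R \<Longrightarrow> dist (F (k j) x) (g x) < 1"
      unfolding eventually_sequentially by blast
    \<comment> \<open>the minimum points of late eigenfunctions keep a fixed distance from the boundary, hence lie in \<open>\<Omega>\<close>\<close>
    obtain x where x: "x \<in> \<Omega>m (r j)" "um (r j) x = - 1"
      using eigenfunction_range(3)[OF eig] by blast
    have "ball x \<delta> \<subseteq> \<Omega>m (r j)"
      using \<delta>(2)[OF eig N0(1)[OF r_ge] C[OF r_ge] x(1)] x(2) by auto
    from outer_ball[OF j(1) _ this] have "ball x (\<delta> - \<delta> / 2) \<subseteq> \<Omega>" using \<delta>(1) by simp
    moreover have "x \<in> ball x (\<delta> - \<delta> / 2)" using \<delta>(1) by simp
    ultimately have "x \<in> \<Omega>" by blast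
    then have "dist (F (k j) x) (g x) < 1" using in_S by (intro j(2)) auto
    then have "g x \<noteq> 0" using x by (auto simp: F_eq zero_extension_def dist_real_def)
    then show ?thesis using \<open>x \<in> \<Omega>\<close> by blast
  qed

  have convex_g: "convex_on \<Omega> g"
  proof (rule convex_onI[OF _ \<Omega>(3)])
    fix t :: real and x y assume t: "0 < t" "t < 1" and xy: "x \<in> \<Omega>" "y \<in> \<Omega>"
    let ?z = "(1 - t) *\<^sub>R x + t *\<^sub>R y"
    have z: "?z \<in> \<Omega>" using convexD_alt[OF \<Omega>(3) xy] t by simp
    show "g ?z \<le> (1 - t) * g x + t * g y"
    proof (rule tendsto_le[OF sequentially_bot])
      show "(\<lambda>j. um (r j) ?z) \<longlonglongrightarrow> g ?z" by (rule lim_pt[OF z])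
      show "(\<lambda>j. (1 - t) * um (r j) x + t * um (r j) y) \<longlonglongrightarrow> (1 - t) * g x + t * g y"
        by (intro tendsto_intros lim_pt xy)
      have "{x, y} \<subseteq> \<Omega>" using xy by simp
      from subset_K[OF _ this]
      show "\<forall>\<^sub>F j in sequentially. um (r j) ?z \<le> (1 - t) * um (r j) x + t * um (r j) y"
        by (auto elim!: eventually_mono intro!: convex_onD[OF Dm(5)] simp: t less_imp_le)
    qed
  qed

  have g_abs: "\<bar>g x\<bar> \<le> 1" if "x \<in> \<Omega>" for x
  proof (rule tendsto_upperbound[OF tendsto_rabs[OF lim_F_pt]])
    show "x \<in> cball 0 R" using that in_S by blast
    have "\<bar>F (k j) x\<bar> \<le> 1" for j using F_bounds[of "k j" x] by simp
    then show "\<forall>\<^sub>F j in sequentially. \<bar>F (k j) x\<bar> \<le> 1" by simp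
  qed simp
  have \<Lambda>_pos: "0 < \<Lambda>" using \<Lambda>(1) c(1) by simp
  have solution: "aleksandrov_solution \<Omega> g (\<lambda>x. \<Lambda> * \<bar>g x\<bar> ^ CARD('n))"
  proof (rule aleksandrov_solution_limit[OF \<Omega>(1,2) convex_g, where D'="\<lambda>j. \<Omega>m (r j)"
        and v="\<lambda>j. um (r j)" and g="\<lambda>j x. \<mu> (r j) * \<bar>um (r j) x\<bar> ^ CARD('n)" and B=\<Lambda>])
    show "continuous_on \<Omega> (\<lambda>x. \<Lambda> * \<bar>g x\<bar> ^ CARD('n))"
      by (intro continuous_intros convex_on_continuous[OF \<Omega>(1) convex_g])
    show "0 \<le> \<Lambda> * \<bar>g x\<bar> ^ CARD('n)" for x using \<Lambda>_pos by simp
    show "\<Lambda> * \<bar>g x\<bar> ^ CARD('n) \<le> \<Lambda>" if "x \<in> \<Omega>" for x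
      using \<Lambda>_pos g_abs[OF that] by (simp add: power_le_one)
    show "aleksandrov_solution (\<Omega>m (r j)) (um (r j)) (\<lambda>x. \<mu> (r j) * \<bar>um (r j) x\<bar> ^ CARD('n))" for j
      by (rule eigenfunction_aleksandrov_solution[OF eig])
    fix K assume K: "compact K" "K \<subseteq> \<Omega>"
    have "uniform_limit K (\<lambda>j x. \<mu> (r j)) (\<lambda>x. \<Lambda>) sequentially"
      using lim_\<mu> by (auto simp: uniform_limit_iff tendsto_iff elim!: eventually_mono)
    moreover have "uniform_limit K (\<lambda>j x. \<bar>um (r j) x\<bar> ^ CARD('n)) (\<lambda>x. \<bar>g x\<bar> ^ CARD('n)) sequentially"
      using g_abs K(2) by (intro uniform_limit_abs_power[OF lim_u[OF K]]) auto
    moreover have "bounded ((\<lambda>x. \<bar>g x\<bar> ^ CARD('n)) ` K)"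
      unfolding bounded_iff using g_abs K(2) by (intro exI[of _ 1]) (auto intro!: power_le_one)
    ultimately show "uniform_limit K (\<lambda>j x. \<mu> (r j) * \<bar>um (r j) x\<bar> ^ CARD('n))
        (\<lambda>x. \<Lambda> * \<bar>g x\<bar> ^ CARD('n)) sequentially"
      by (intro uniform_lim_mult) (auto simp: bounded_iff)
  qed (use Dm subset_K lim_u in auto)
  have "continuous_on (closure \<Omega>) g" by (rule continuous_on_subset[OF g(1) R(2)])
  with mono_r \<Lambda>_pos lim_\<mu> lim_u convex_g nonzero solution zero show ?thesis
    unfolding \<mu>_def by blast
qed

end
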